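(* Let $x>0$, let $r\in\mathbb{Z}\setminus\mathbb{N}$ and let $\ell\in\mathbb{N}\cup\{0\}$ be arbitrary such that $\ell\ge 1-r$. Then the following hold. (1) For a fixed $s\in\mathbb{Z}$ with $s>r+\ell$ and $s\neq \ell+1$, or a fixed $s\in\mathbb{C}\setminus\mathbb{Z}$, we have, around $t=1-r-\ell$, $$\Theta(r,s,t,x)=(-1)^{r-1}\frac{(r+\ell-1)!}{\ell!}x^{\ell}(-r)!\,\zeta(s-\ell)+\sum_{k=0}^{r+\ell-1}\frac{(r+\ell-1)!\,\zeta(r-k)}{x^{1-r-\ell+k}\,k!\,(r+\ell-k-1)!}\zeta(-r+s-\ell+k+1)+O(|t-(1-r-\ell)|).$$ (2) For $s=\ell+1$, we have, around $t=1-r-\ell$, $$\Theta(r,s,t,x)=(-1)^{r-1}(-r)!\,x^{\ell}\frac{(r+\ell-1)!}{\ell!\,(t-(1-r-\ell))}+(-1)^{r-1}(-r)!\,x^{\ell}\frac{(r+\ell-1)!}{\ell!}\left(\gamma-\log(x)+H_{\ell}-H_{r+\ell-1}\right)$$ $$\qquad+\sum_{k=0}^{r+\ell-1}\binom{r+\ell-1}{k}\frac{\zeta(r-k)}{x^{k-r-\ell+1}}\zeta(k-r+2)+O(|t-(1-r-\ell)|).$$ (3) For a fixed $s\in\mathbb{Z}\setminus\mathbb{N}$ with $s\le r+\ell$, we have, around $t=1-r-\ell$, $$\Theta(r,s,t,x)=(-1)^{r-1}x^{\ell}\frac{(-r)!(r+\ell-1)!}{\ell!}\zeta(s-\ell)+\sum_{k=0}^{r+\ell-1}\frac{\zeta(r-k)(r+\ell-1)!}{x^{k-r-\ell+1}k!(r+\ell-k-1)!}\zeta(s+1-r-\ell+k)$$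 $$\qquad+(-1)^{s-1}x^{s-1}\frac{(r+\ell-1)!(-s)!}{(r+\ell-s)!}\zeta(s-\ell)+O(|t-(1-r-\ell)|).$$ (4) For a fixed $s\in\mathbb{N}$ with $s\le r+\ell$, we have, around $t=1-r-\ell$, $$\Theta(r,s,t,x)=x^{s-1}\frac{(r+\ell-1)!}{(r+\ell-s)!(s-1)!}\frac{\zeta(s-\ell)}{(t-(1-r-\ell))}+x^{s-1}\frac{(r+\ell-1)!}{(r+\ell-s)!(s-1)!}\left(\gamma-H_{r+\ell-1}+H_{s-1}-\log(x)\right)\zeta(s-\ell)$$ $$\qquad-(-1)^{r}x^{\ell}\frac{(-r)!(r+\ell-1)!}{\ell!}\zeta(s-\ell)+\sum_{\substack{k=0\\ k\neq r+\ell-s}}^{r+\ell-1}\frac{(r+\ell-1)!\,\zeta(r-k)}{(r+\ell-k-1)!\,x^{k-r-\ell+1}\,k!}\zeta(s-r-\ell+k+1)+O(|t-(1-r-\ell)|).$$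
   Context: $\mathbb{N}=\{1,2,3,\dots\}$. For $x>0$ and $(r,s,t)\in\mathbb{C}^3$ with $\Re(r+t)>1$, $\Re(s+t)>1$, $\Re(r+s+t)>2$, the generalized Mordell–Tornheim zeta function is the absolutely convergent series $\Theta(r,s,t,x)=\sum_{n=1}^{\infty}\sum_{m=1}^{\infty}\frac{1}{n^r m^s (n+mx)^t}$. For fixed $x>0$ it continues meromorphically to $(r,s,t)\in\mathbb{C}^3$, with singularities only on the hyperplanes $r+t=1-\ell$, $s+t=1-\ell$ ($\ell\in\mathbb{N}\cup\{0\}$) and $r+s+t=2$; $\Theta$ also denotes this continuation. For fixed $r,s$, it is considered as a meromorphic function of the single complex variable $t$; "around $t=t_0$" means as $t\to t_0$, $t\neq t_0$. $\zeta$ is the Riemann zeta function, $\gamma$ is Euler's constant, and $H_n=\sum_{i=1}^n 1/i$ with $H_0=0$. *)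

theory Defs
  imports "HOL-Complex_Analysis.Complex_Analysis" "HOL-Library.Landau_Symbols"
begin

text \<open>The value at the pole \<open>s = 1\<close> is left unspecified.\<close>

definition riemann_zeta :: "complex \<Rightarrow> complex" where
  "riemann_zeta = (SOME f. f holomorphic_on (- {1}) \<and>
     (\<forall>s. Re s > 1 \<longrightarrow> f s = (\<Sum>\<^sub>\<infinity>n\<in>{1::nat..}. 1 / of_nat n powr s)))"

definition MT_series :: "real \<Rightarrow> complex \<Rightarrow> complex \<Rightarrow> complex \<Rightarrow> complex" where
  "MT_series x r s t =
     (\<Sum>\<^sub>\<infinity>(n, m) \<in> {1::nat..} \<times> {1::nat..}.
        1 / (of_nat n powr r * of_nat m powr s * of_real (real n + real m * x) powr t))"

definition MT_convergence_region :: "(complex \<times> complex \<times> complex) set" where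
  "MT_convergence_region =
     {(r, s, t). Re (r + t) > 1 \<and> Re (s + t) > 1 \<and> Re (r + s + t) > 2}"

definition MT_singular_set :: "(complex \<times> complex \<times> complex) set" where
  "MT_singular_set =
     {(r, s, t). (\<exists>l::nat. r + t = 1 - of_nat l) \<or> (\<exists>l::nat. s + t = 1 - of_nat l) \<or> r + s + t = 2}"

text \<open>Holomorphy in three variables: the Frechet derivative exists and is complex-linear.\<close>

definition holomorphic3_on ::
    "(complex \<times> complex \<times> complex \<Rightarrow> complex) \<Rightarrow> (complex \<times> complex \<times> complex) set \<Rightarrow> bool" where
  "holomorphic3_on f S \<longleftrightarrow>
     (\<forall>p\<in>S. \<exists>a b c. (f has_derivative (\<lambda>(u, v, w). a * u + b * v + c * w)) (at p within S))"

text \<open>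
  The complement of the singular hyperplanes is open and connected and contains the region of
  convergence, so this determines \<open>\<Theta>\<close> uniquely off the hyperplanes. No condition is imposed on the
  hyperplanes themselves: their points are the (potential) poles, where the values of \<open>\<Theta>\<close> carry no
  meaning.
\<close>

definition is_MT_zeta :: "real \<Rightarrow> (complex \<Rightarrow> complex \<Rightarrow> complex \<Rightarrow> complex) \<Rightarrow> bool" where
  "is_MT_zeta x \<Theta> \<longleftrightarrow>
     holomorphic3_on (\<lambda>(r, s, t). \<Theta> r s t) (- MT_singular_set) \<and>
     (\<forall>(r, s, t) \<in> MT_convergence_region. \<Theta> r s t = MT_series x r s t)"

end

theory Submission
  imports Defs
begin

text \<open>
  Write \<open>r = -a\<close> and \<open>t\<^sub>0 = -N\<close>, so that \<open>l = a + N + 1\<close>. For fixed \<open>r\<close> and \<open>s\<close> the identity theorem in the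
  single variable \<open>t\<close> suffices, because the slice of the singular set is discrete. For large \<open>Re t\<close> the
  sum over \<open>n\<close> is expanded by Euler-Maclaurin summation at \<open>y = m x\<close>,
  \<open>\<Sum>n. n^a (n + y)^(-t) = a! / ((t-1)...(t-a-1)) y^(a+1-t)
      + (\<Sum>k. binom(-t, k) \<zeta>(-a-k) y^(-t-k)) + R(t, y)\<close>,
  where the remainder is holomorphic in a left half plane, small as \<open>y \<rightarrow> \<infinity>\<close>, and vanishes at \<open>t = -N\<close>.
  Summing over \<open>m\<close> turns the powers of \<open>y = m x\<close> into zeta values at \<open>s + t - a - 1\<close> and \<open>s + t + k\<close>. At
  \<open>t\<^sub>0\<close> each term is either regular or a holomorphic function times \<open>\<zeta>(1 + (t - t\<^sub>0))\<close>; the four cases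
  differ only in which term, if any, hits the pole of \<open>\<zeta>\<close>.
\<close>

text \<open>\<open>\<Theta>\<close> is given only as a function holomorphic off the hyperplanes that
  agrees with the double series in the region of convergence, while \<open>t = -N\<close> may lie
  far to the left. Hence a formula is needed whose uncontrolled part has a known value at
  \<open>-N\<close>. For this reason the remainder estimate keeps the factor
  \<open>-t gchoose Suc K\<close>: it vanishes at \<open>t = -N\<close> once
  \<open>N \<le> K\<close>, so the remainder contributes only O(t + N). The order \<open>K\<close>
  is chosen after \<open>s\<close>, large enough that the explicit sum contains the term whose zeta
  factor has a pole. At a pole of zeta the coefficient matters to first order. The harmonic numbers
  are logarithmic derivatives of \<open>em_lead\<close> and of \<open>-t gchoose k\<close> for
  \<open>k \<le> N\<close>; the power of \<open>x\<close> supplies \<open>- ln x\<close>. For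
  \<open>k > N\<close> the binomial has a simple zero at \<open>-N\<close>, which cancels the pole
  and leaves a finite term made of factorials. The pole of the leading term
  (\<open>s = l + 1\<close>) and that of a summand (\<open>s = N + 1 - k\<close>) never coincide.
  Zeta itself is continued by the same expansion at \<open>y = 1\<close>, so its values at the
  nonpositive integers and its constant term at 1 come from the same remainder.\<close>

section \<open>Euler-Maclaurin steps\<close>

text \<open>The recursion makes the leading terms of \<open>em_step\<close> cancel; the value is \<open>\<zeta>(-n)\<close>, see
  \<open>riemann_zeta_neg_of_nat\<close>.\<close>

fun zeta_neg :: "nat \<Rightarrow> complex" where
  "zeta_neg n = (1 / of_nat (n + 2) - 1 - (\<Sum>k<n. of_nat (Suc n choose k) * zeta_neg k)) / of_nat (Suc n)"

declare zeta_neg.simps [simp del]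

text \<open>The recursion solved for its top summand. Up to normalisation it is the recursion of the
  Bernoulli numbers, \<open>zeta_neg k\<close> being - B_(k+1) / (k+1) with B_1 = 1/2.\<close>

lemma sum_choose_zeta_neg:
  "(\<Sum>k<n. of_nat (n choose k) * zeta_neg k) = 1 / of_nat (Suc n) - 1"
proof (cases n)
  case (Suc m)
  have "of_nat (Suc m choose m) * zeta_neg m = 1 / of_nat (m + 2) - 1 - (\<Sum>k<m. of_nat (Suc m choose k) * zeta_neg k)"
    by (subst zeta_neg.simps) (simp del: of_nat_Suc)
  thus ?thesis using Suc by simp
qed simp

section \<open>Taylor estimates over a unit interval for complex powers\<close>

text \<open>The integral of \<open>u powr (w - 1)\<close> over \<open>[y, y + 1]\<close>.\<close>

definition powr_integral :: "complex \<Rightarrow> real \<Rightarrow> complex" where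
  "powr_integral w y =
     (if w = 0 then of_real (ln (y + 1)) - of_real (ln y)
      else (of_real (y + 1) powr w - of_real y powr w) / w)"

text \<open>Taylor expansion of \<open>F\<close> along the segment from 0 to 1. Since
  \<open>Re v \<le> n\<close>, the last derivative is largest in norm at \<open>h = 0\<close>, which
  gives the power of \<open>y\<close>. The factor \<open>v gchoose n\<close> is kept in the bound
  because its zeros are exploited later.\<close>

lemma taylor_remainder_powr:
  fixes F :: "complex \<Rightarrow> complex" and v c :: complex and y :: real
  assumes y: "y > 0" and v: "Re v \<le> of_nat n"
    and F: "\<And>h. Re h \<ge> 0 \<Longrightarrow> (F has_field_derivative c * (of_real y + h) powr v) (at h)"
  shows "norm (F 1 - F 0 - (\<Sum>i<n. c * (v gchoose i) / of_nat (Suc i) * of_real y powr (v - of_nat i)))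
           \<le> norm (c * (v gchoose n)) * y powr (Re v - of_nat n)"
proof -
  \<comment> \<open>These are the successive derivatives of \<open>F\<close>. Index 0 is
    \<open>F\<close> itself, so the derivative of order \<open>j + 1\<close> carries
    \<open>v gchoose j\<close>.\<close>
  define f where "f = (\<lambda>i h. case i of 0 \<Rightarrow> F h
     | Suc j \<Rightarrow> c * fact j * (v gchoose j) * (of_real y + h) powr (v - of_nat j))"
  define S where "S = closed_segment (0::complex) 1"
  have S: "Re h \<ge> 0 \<and> Im h = 0" if "h \<in> S" for h
    using that by (auto simp: S_def in_segment)
  have "norm (f 0 1 - (\<Sum>i\<le>n. f i 0 * (1 - 0) ^ i / fact i))
      \<le> (fact n * norm (c * (v gchoose n)) * y powr (Re v - of_nat n)) * norm (1 - 0 :: complex) ^ Suc n / fact n"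
  proof (rule complex_Taylor[where S = S])
    show "convex S" "0 \<in> S" "1 \<in> S" by (auto simp: S_def)
    show "(f i has_field_derivative f (Suc i) h) (at h within S)" if "h \<in> S" for i h
    proof (cases i)
      case 0
      thus ?thesis using F[of h] S[OF that] by (auto simp: f_def intro: has_field_derivative_at_within)
    next
      case (Suc j)
      have "of_real y + h \<notin> \<real>\<^sub>\<le>\<^sub>0" using S[OF that] y by (auto simp: complex_nonpos_Reals_iff)
      hence "((\<lambda>h. (of_real y + h) powr (v - of_nat j)) has_field_derivative
           ((v - of_nat j) * (of_real y + h) powr (v - of_nat j - 1))) (at h)"
        by (auto intro!: derivative_eq_intros)
      hence "((\<lambda>h. c * fact j * (v gchoose j) * (of_real y + h) powr (v - of_nat j)) has_field_derivative
           c * fact j * (v gchoose j) * ((v - of_nat j) * (of_real y + h) powr (v - of_nat j - 1))) (at h)"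
        by (rule DERIV_cmult)
      also have "c * fact j * (v gchoose j) * ((v - of_nat j) * (of_real y + h) powr (v - of_nat j - 1))
          = c * fact (Suc j) * (v gchoose Suc j) * (of_real y + h) powr (v - of_nat (Suc j))"
      proof -
        have "(v - of_nat j) * (v gchoose j) = of_nat (Suc j) * (v gchoose Suc j)"
          using gbinomial_mult_1[of v j] by (simp add: algebra_simps)
        thus ?thesis by (simp add: diff_diff_eq add.commute mult.assoc) (simp add: mult_ac)
      qed
      finally show ?thesis
        by (auto simp: Suc f_def intro: has_field_derivative_at_within)
    qed
    show "norm (f (Suc n) h) \<le> fact n * norm (c * (v gchoose n)) * y powr (Re v - of_nat n)"
      if "h \<in> S" for h
    proof -
      have eq: "of_real y + h = of_real (y + Re h)" using S[OF that] by (simp add: complex_eq_iff)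
      have "norm ((of_real y + h) powr (v - of_nat n)) = (y + Re h) powr (Re v - of_nat n)"
        unfolding eq using S[OF that] y by (subst norm_powr_real_powr) (auto simp del: of_real_add)
      also have "\<dots> \<le> y powr (Re v - of_nat n)"
        using S[OF that] y v by (intro powr_mono2') auto
      finally have *: "norm ((of_real y + h) powr (v - of_nat n)) \<le> y powr (Re v - of_nat n)" .
      show ?thesis
        using mult_left_mono[OF *, of "norm c * fact n * norm (v gchoose n)"]
        by (simp add: f_def norm_mult mult_ac)
    qed
  qed
  also have "(\<Sum>i\<le>n. f i 0 * (1 - 0) ^ i / fact i) =
      F 0 + (\<Sum>i<n. c * (v gchoose i) / of_nat (Suc i) * of_real y powr (v - of_nat i))"
    unfolding lessThan_Suc_atMost [symmetric] sum.lessThan_Suc_shift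
    by (auto simp: f_def intro!: sum.cong)
  finally show ?thesis by (simp add: f_def diff_diff_eq)
qed

lemma taylor_powr:
  fixes w :: complex and y :: real
  assumes y: "y > 0" and w: "Re w \<le> of_nat (Suc n)"
  shows "norm (of_real (y + 1) powr w - of_real y powr w
               - (\<Sum>i<n. (w gchoose Suc i) * of_real y powr (w - 1 - of_nat i)))
           \<le> of_nat (Suc n) * norm (w gchoose Suc n) * y powr (Re w - 1 - of_nat n)"
proof -
  \<comment> \<open>Differentiating the power gives \<open>c = w\<close> and
    \<open>v = w - 1\<close>; absorption turns these coefficients into those of the binomial
    series.\<close>
  have *: "w * ((w - 1) gchoose i) = of_nat (Suc i) * (w gchoose Suc i)" for i
    by (rule gbinomial_absorption [symmetric])
  have "norm ((of_real y + 1) powr w - (of_real y + 0) powr w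
         - (\<Sum>i<n. w * ((w - 1) gchoose i) / of_nat (Suc i) * of_real y powr (w - 1 - of_nat i)))
        \<le> norm (w * ((w - 1) gchoose n)) * y powr (Re (w - 1) - of_nat n)"
  proof (rule taylor_remainder_powr)
    fix h :: complex assume "Re h \<ge> 0"
    hence "of_real y + h \<notin> \<real>\<^sub>\<le>\<^sub>0" using y by (auto simp: complex_nonpos_Reals_iff)
    thus "((\<lambda>h. (of_real y + h) powr w) has_field_derivative w * (of_real y + h) powr (w - 1)) (at h)"
      by (auto intro!: derivative_eq_intros)
  qed (use assms in auto)
  thus ?thesis unfolding * by (simp add: norm_mult del: of_nat_Suc)
qed

lemma taylor_powr_integral:
  fixes w :: complex and y :: real
  assumes y: "y > 0" and w: "Re w \<le> of_nat (Suc n)"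
  shows "norm (powr_integral w y
               - (\<Sum>i<n. ((w - 1) gchoose i) / of_nat (Suc i) * of_real y powr (w - 1 - of_nat i)))
           \<le> norm ((w - 1) gchoose n) * y powr (Re w - 1 - of_nat n)"
proof -
  define F where "F = (\<lambda>h. if w = 0 then Ln (of_real y + h) else (of_real y + h) powr w / w)"
  have "norm (F 1 - F 0
         - (\<Sum>i<n. 1 * ((w - 1) gchoose i) / of_nat (Suc i) * of_real y powr (w - 1 - of_nat i)))
        \<le> norm (1 * ((w - 1) gchoose n)) * y powr (Re (w - 1) - of_nat n)"
  proof (rule taylor_remainder_powr)
    fix h :: complex assume h: "Re h \<ge> 0"
    hence *: "of_real y + h \<notin> \<real>\<^sub>\<le>\<^sub>0" "of_real y + h \<noteq> 0"
      using y by (auto simp: complex_nonpos_Reals_iff complex_eq_iff)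
    show "(F has_field_derivative 1 * (of_real y + h) powr (w - 1)) (at h)"
    proof (cases "w = 0")
      case True
      have "((\<lambda>h. Ln (of_real y + h)) has_field_derivative inverse (of_real y + h)) (at h)"
        using * by (auto intro!: derivative_eq_intros simp: field_simps)
      thus ?thesis using True * by (simp add: F_def powr_minus)
    next
      case False
      have "((\<lambda>h. (of_real y + h) powr w) has_field_derivative w * (of_real y + h) powr (w - 1)) (at h)"
        using * by (auto intro!: derivative_eq_intros)
      from DERIV_cdivide[OF this, of w] show ?thesis using False by (simp add: F_def)
    qed
  qed (use assms in auto)
  moreover have "F 1 - F 0 = powr_integral w y"
  proof -
    have "Ln (of_real y + 1) = of_real (ln (y + 1))"
      using y Ln_of_real[of "y + 1"] by simp
    thus ?thesis using y by (simp add: F_def powr_integral_def Ln_of_real diff_divide_distrib)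
  qed
  ultimately show ?thesis by simp
qed

lemma holomorphic_on_gbinomial [holomorphic_intros]:
  assumes "f holomorphic_on A"
  shows "(\<lambda>z. f z gchoose k) holomorphic_on A"
  unfolding gbinomial_prod_rev using assms by (intro holomorphic_intros) auto

text \<open>Weierstrass M-test on closed balls: \<open>b\<close> is bounded on each of them by
  compactness, so a majorant that varies with \<open>t\<close> suffices for locally uniform
  convergence.\<close>

lemma holomorphic_on_suminf_majorised:
  fixes f :: "nat \<Rightarrow> complex \<Rightarrow> complex"
  assumes V: "open V" and hol: "\<And>n. f n holomorphic_on V"
    and b: "continuous_on V b" and g: "summable g" "\<And>n. g n \<ge> 0"
    and le: "\<And>n t. t \<in> V \<Longrightarrow> norm (f n t) \<le> b t * g n"
  shows "(\<lambda>t. \<Sum>n. f n t) holomorphic_on V"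
proof (rule holomorphic_uniform_sequence[OF V])
  show "(\<lambda>t. \<Sum>i<n. f i t) holomorphic_on V" for n
    using hol by (intro holomorphic_intros) auto
  show "\<exists>d>0. cball x d \<subseteq> V \<and>
         uniform_limit (cball x d) (\<lambda>n t. \<Sum>i<n. f i t) (\<lambda>t. \<Sum>n. f n t) sequentially"
    if "x \<in> V" for x
  proof -
    obtain d where d: "d > 0" "cball x d \<subseteq> V"
      using V \<open>x \<in> V\<close> open_contains_cball by blast
    have "compact (b ` cball x d)"
      using continuous_on_subset[OF b d(2)] by (intro compact_continuous_image) auto
    then obtain B where B: "\<And>t. t \<in> cball x d \<Longrightarrow> b t \<le> B"
      using bounded_imp_bdd_above[OF compact_imp_bounded] by (fastforce simp: bdd_above_def)
    have "uniform_limit (cball x d) (\<lambda>n t. \<Sum>i<n. f i t) (\<lambda>t. \<Sum>n. f n t) sequentially"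
    proof (rule Weierstrass_m_test)
      show "summable (\<lambda>n. B * g n)" using g by (intro summable_mult) auto
      show "norm (f n t) \<le> B * g n" if "t \<in> cball x d" for n t
        using le[of t n] B[OF that] that d g(2)[of n]
        by (meson mult_right_mono order_trans subsetD)
    qed
    thus ?thesis using d by blast
  qed
qed

text \<open>The quotient has a removable singularity at \<open>w = 0\<close>, and the logarithmic
  branch of the definition is the value that fills it. This keeps \<open>em_step\<close> entire in
  \<open>t\<close>, in particular at \<open>t = 1\<close>.\<close>

lemma holomorphic_on_powr_integral:
  assumes "y > 0"
  shows "(\<lambda>w. powr_integral w y) holomorphic_on UNIV"
proof -
  let ?f = "\<lambda>w. of_real (y + 1) powr w - of_real y powr w :: complex"
  have nz: "of_real (y + 1) \<noteq> (0::complex)" "of_real y \<noteq> (0::complex)"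
    using assms of_real_eq_0_iff[of "y + 1", where ?'a = complex] by auto
  have "(\<lambda>z. if z = 0 then deriv ?f 0 else (?f z - ?f 0) / (z - 0)) holomorphic_on UNIV"
  proof (rule pole_lemma)
    show "?f holomorphic_on UNIV" using nz by (auto intro!: holomorphic_intros)
  qed auto
  moreover have "deriv ?f 0 = of_real (ln (y + 1)) - of_real (ln y)"
  proof (rule DERIV_imp_deriv)
    show "(?f has_field_derivative of_real (ln (y + 1)) - of_real (ln y)) (at 0)"
      using nz assms by (auto intro!: derivative_eq_intros simp: Ln_of_real simp del: of_real_add)
  qed
  moreover have "?f 0 = 0" using nz by (simp del: of_real_add)
  ultimately show ?thesis by (simp only: powr_integral_def[abs_def] diff_zero)
qed

text \<open>The defect of a telescoping ansatz: for \<open>t \<noteq> 1\<close> it equals (y+1)^(-t)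
  - (Q(y) - Q(y+1)), where Q(y) is y^(1-t)/(t-1) plus the sum over \<open>k < K\<close> of
  \<open>(-t gchoose k) * zeta_neg k\<close> times y^(-t-k).\<close>

definition em_step :: "nat \<Rightarrow> complex \<Rightarrow> real \<Rightarrow> complex" where
  "em_step K t y = of_real (y + 1) powr (-t) - powr_integral (1 - t) y
     + (\<Sum>k<K. (-t gchoose k) * zeta_neg k *
          (of_real (y + 1) powr (-t - of_nat k) - of_real y powr (-t - of_nat k)))"

lemma holomorphic_on_em_step:
  assumes "y > 0"
  shows "(\<lambda>t. em_step K t y) holomorphic_on A"
proof -
  have nz: "of_real (y + 1) \<noteq> (0::complex)" "of_real y \<noteq> (0::complex)"
    using assms of_real_eq_0_iff[of "y + 1", where ?'a = complex] by auto
  have "((\<lambda>w. powr_integral w y) \<circ> (\<lambda>t. 1 - t)) holomorphic_on UNIV"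
    by (rule holomorphic_on_compose_gen[OF _ holomorphic_on_powr_integral[OF assms]])
       (auto intro!: holomorphic_intros)
  hence "(\<lambda>t. em_step K t y) holomorphic_on UNIV"
    unfolding em_step_def o_def using nz by (intro holomorphic_intros) auto
  thus ?thesis by (rule holomorphic_on_subset) auto
qed

lemma sum_triangle:
  fixes g :: "nat \<Rightarrow> nat \<Rightarrow> 'a :: comm_monoid_add"
  shows "(\<Sum>k<K. \<Sum>j<K-k. g k (Suc (k + j))) = (\<Sum>i<Suc K. \<Sum>k<i. g k i)"
proof (induction K)
  case (Suc K)
  have "(\<Sum>k<Suc K. \<Sum>j<Suc K - k. g k (Suc (k + j)))
      = (\<Sum>k<K. (\<Sum>j<K-k. g k (Suc (k + j))) + g k (Suc K)) + g K (Suc K)"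
    by (auto simp: Suc_diff_le intro!: sum.cong)
  also have "\<dots> = (\<Sum>i<Suc (Suc K). \<Sum>k<i. g k i)"
    using Suc.IH by (simp add: sum.distrib add_ac)
  finally show ?case .
qed auto

text \<open>Here \<open>w\<close> stands for \<open>-t\<close> and \<open>p i\<close> for y^(-t-i).
  Trinomial revision, binom(w,k) binom(w-k,i-k) = binom(w,i) binom(i,k), makes the coefficient of
  \<open>p i\<close> equal to binom(w,i) times 1 - 1/(i+1) plus the sum over \<open>k < i\<close> of
  binom(i,k) \<open>zeta_neg k\<close>, which is zero by \<open>sum_choose_zeta_neg\<close>.\<close>

lemma em_step_main_terms_cancel:
  fixes p :: "nat \<Rightarrow> complex"
  shows "(\<Sum>i<Suc K. (w gchoose i) * p i) - (\<Sum>i<Suc K. (w gchoose i) / of_nat (Suc i) * p i)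
    + (\<Sum>k<K. (w gchoose k) * zeta_neg k * (\<Sum>j<K-k. (w - of_nat k gchoose Suc j) * p (Suc (k + j)))) = 0"
proof -
  have "(\<Sum>k<K. (w gchoose k) * zeta_neg k * (\<Sum>j<K-k. (w - of_nat k gchoose Suc j) * p (Suc (k + j))))
      = (\<Sum>k<K. \<Sum>j<K-k. (w gchoose Suc (k + j)) * of_nat (Suc (k + j) choose k) * zeta_neg k * p (Suc (k + j)))"
    unfolding sum_distrib_left
  proof (intro sum.cong refl)
    fix k j
    show "(w gchoose k) * zeta_neg k * ((w - of_nat k gchoose Suc j) * p (Suc (k + j))) =
          (w gchoose Suc (k + j)) * of_nat (Suc (k + j) choose k) * zeta_neg k * p (Suc (k + j))"
      using gbinomial_trinomial_revision[of k "Suc (k + j)" w]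
      by (simp add: binomial_gbinomial Suc_diff_le mult_ac)
  qed
  also have "\<dots> = (\<Sum>i<Suc K. \<Sum>k<i. (w gchoose i) * of_nat (i choose k) * zeta_neg k * p i)"
    by (rule sum_triangle)
  also have "\<dots> = (\<Sum>i<Suc K. (w gchoose i) * p i * (\<Sum>k<i. of_nat (i choose k) * zeta_neg k))"
    by (simp add: sum_distrib_left mult_ac)
  finally have *: "(\<Sum>k<K. (w gchoose k) * zeta_neg k * (\<Sum>j<K-k. (w - of_nat k gchoose Suc j) * p (Suc (k + j))))
      = (\<Sum>i<Suc K. (w gchoose i) * p i * (1 / of_nat (Suc i) - 1))"
    unfolding sum_choose_zeta_neg .
  show ?thesis
    unfolding * sum_subtractf [symmetric] sum.distrib [symmetric]
    by (intro sum.neutral) (auto simp: algebra_simps)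
qed

text \<open>The binomial factor is what makes every remainder vanish at \<open>t = -N\<close> for \<open>N \<le> K\<close>.\<close>

lemma norm_em_step_le:
  "\<exists>M\<ge>0. \<forall>t y. y > 0 \<longrightarrow> Re t \<ge> - real (Suc K) \<longrightarrow>
      norm (em_step K t y) \<le> M * norm (-t gchoose Suc K) * y powr (- Re t - real K - 1)"
proof -
  define M where "M = real (Suc K) + 1 + (\<Sum>k<K. norm (zeta_neg k) * (Suc K choose k) * real (Suc (K - k)))"
  show ?thesis
  proof (intro exI[of _ M] conjI allI impI)
    show "M \<ge> 0" unfolding M_def by (intro add_nonneg_nonneg sum_nonneg mult_nonneg_nonneg) auto
    fix t :: complex and y :: real
    assume y: "y > 0" and t: "Re t \<ge> - real (Suc K)"
    define p where "p = (\<lambda>i. of_real y powr (-t - of_nat i) :: complex)"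
    define G where "G = norm (-t gchoose Suc K)"
    define Y where "Y = y powr (- Re t - real K - 1)"
    \<comment> \<open>The three kinds of Taylor remainder are cut at orders \<open>K\<close>,
      \<open>Suc K\<close> and \<open>K - k\<close>, so that each time the first omitted power is
      y^(-t-K-1).\<close>
    define R1 where "R1 = of_real (y + 1) powr (-t) - of_real y powr (-t)
                            - (\<Sum>i<K. (-t gchoose Suc i) * of_real y powr (-t - 1 - of_nat i))"
    define R2 where "R2 = powr_integral (1 - t) y
            - (\<Sum>i<Suc K. ((1 - t - 1) gchoose i) / of_nat (Suc i) * of_real y powr (1 - t - 1 - of_nat i))"
    define R3 where "R3 = (\<lambda>k. of_real (y + 1) powr (-t - of_nat k) - of_real y powr (-t - of_nat k)
            - (\<Sum>i<K-k. ((-t - of_nat k) gchoose Suc i) * of_real y powr (-t - of_nat k - 1 - of_nat i)))"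
    have R1: "norm R1 \<le> real (Suc K) * G * Y"
      using taylor_powr[OF y, of "-t" K] t by (simp add: R1_def G_def Y_def algebra_simps)
    have R2: "norm R2 \<le> G * Y"
      using taylor_powr_integral[OF y, of "1-t" "Suc K"] t by (simp add: R2_def G_def Y_def algebra_simps)
    have R3: "norm ((-t gchoose k) * zeta_neg k * R3 k)
                \<le> norm (zeta_neg k) * (Suc K choose k) * real (Suc (K - k)) * (G * Y)" if "k < K" for k
    proof -
      have "norm (R3 k) \<le> real (Suc (K - k)) * norm (-t - of_nat k gchoose Suc (K - k)) * Y"
      proof -
        have e: "Re (-t - of_nat k) - 1 - real (K - k) = - Re t - real K - 1"
          using that by (simp add: of_nat_diff)
        have "Re (-t - of_nat k) \<le> real (Suc (K - k))"
          using that t by (simp add: of_nat_diff)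
        from taylor_powr[OF y this] show ?thesis
          unfolding R3_def Y_def e .
      qed
      \<comment> \<open>Trinomial revision again: it exposes the common factor
        \<open>-t gchoose Suc K\<close> in the corrections as well.\<close>
      moreover have "norm (-t gchoose k) * norm (-t - of_nat k gchoose Suc (K - k)) = G * (Suc K choose k)"
      proof -
        have "(-t gchoose k) * (-t - of_nat k gchoose Suc (K - k)) = (-t gchoose Suc K) * of_nat (Suc K choose k)"
          using gbinomial_trinomial_revision[of k "Suc K" "-t"] that
          by (simp add: binomial_gbinomial Suc_diff_le)
        from arg_cong[OF this, of norm] show ?thesis unfolding G_def by (simp only: norm_mult norm_of_nat)
      qed
      moreover have "norm ((-t gchoose k) * zeta_neg k * R3 k) = norm (zeta_neg k) * norm (-t gchoose k) * norm (R3 k)"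
        by (simp add: norm_mult mult_ac)
      ultimately have "norm ((-t gchoose k) * zeta_neg k * R3 k) \<le>
          norm (zeta_neg k) * norm (-t gchoose k) * (real (Suc (K - k)) * norm (-t - of_nat k gchoose Suc (K - k)) * Y)"
        by (simp only: mult_left_mono mult_nonneg_nonneg norm_ge_zero)
      also have "\<dots> = norm (zeta_neg k) * real (Suc (K - k)) * Y *
                   (norm (-t gchoose k) * norm (-t - of_nat k gchoose Suc (K - k)))"
        by (simp only: mult_ac)
      finally show ?thesis
        unfolding \<open>norm (-t gchoose k) * norm (-t - of_nat k gchoose Suc (K - k)) = G * (Suc K choose k)\<close>
        by (simp only: mult_ac)
    qed
    have "em_step K t y = R1 - R2 + (\<Sum>k<K. (-t gchoose k) * zeta_neg k * R3 k)"
    proof -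
      have 1: "of_real (y + 1) powr (-t) = R1 + (\<Sum>i<Suc K. (-t gchoose i) * p i)"
        by (simp add: R1_def p_def sum.lessThan_Suc_shift diff_diff_eq del: sum.lessThan_Suc)
      have 2: "powr_integral (1 - t) y = R2 + (\<Sum>i<Suc K. (-t gchoose i) / of_nat (Suc i) * p i)"
        by (simp add: R2_def p_def)
      have 3: "of_real (y + 1) powr (-t - of_nat k) - of_real y powr (-t - of_nat k) =
               R3 k + (\<Sum>j<K-k. (-t - of_nat k gchoose Suc j) * p (Suc (k + j)))" for k
        by (simp add: R3_def p_def diff_diff_eq add_ac)
      show ?thesis
        unfolding em_step_def 1 2 3 using em_step_main_terms_cancel[of "-t" p K]
        by (simp add: algebra_simps sum.distrib)
    qed
    hence "norm (em_step K t y) \<le> norm R1 + norm R2 + (\<Sum>k<K. norm ((-t gchoose k) * zeta_neg k * R3 k))"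
      by (auto intro!: order.trans[OF norm_triangle_ineq] order.trans[OF norm_triangle_ineq4] add_mono norm_sum)
    also have "\<dots> \<le> real (Suc K) * G * Y + G * Y
        + (\<Sum>k<K. norm (zeta_neg k) * (Suc K choose k) * real (Suc (K - k)) * (G * Y))"
      using R1 R2 R3 by (intro add_mono sum_mono) auto
    also have "\<dots> = M * G * Y"
      by (simp add: M_def algebra_simps sum_distrib_left sum_distrib_right)
    finally show "norm (em_step K t y) \<le> M * norm (-t gchoose Suc K) * y powr (- Re t - real K - 1)"
      by (simp add: G_def Y_def)
  qed
qed

section \<open>Summing the steps\<close>

definition em_rem :: "nat \<Rightarrow> complex \<Rightarrow> real \<Rightarrow> complex" where
  "em_rem K t y = (\<Sum>j. em_step K t (y + real j))"

text \<open>The exponent is split as (1 - Re t - K) + (-2). The first part is nonpositive and is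
  evaluated at \<open>y\<close>, keeping the decay needed later for the sum over \<open>m\<close>;
  the second makes a summable majorant that is uniform in \<open>y \<ge> x\<close>.\<close>

lemma norm_em_step_shift_le:
  assumes x: "x > 0"
  shows "\<exists>g::nat \<Rightarrow> real. summable g \<and> (\<forall>j. g j \<ge> 0) \<and> (\<forall>t y j. Re t \<ge> 1 - real K \<longrightarrow> y \<ge> x \<longrightarrow>
           norm (em_step K t (y + real j)) \<le> norm (-t gchoose Suc K) * y powr (1 - Re t - real K) * g j)"
proof -
  obtain M where M: "M \<ge> 0" "\<And>t y. y > 0 \<Longrightarrow> Re t \<ge> - real (Suc K) \<Longrightarrow>
      norm (em_step K t y) \<le> M * norm (-t gchoose Suc K) * y powr (- Re t - real K - 1)"
    using norm_em_step_le[of K] by blast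
  define g where "g = (\<lambda>j. M * (x + real j) powr (-2))"
  have "summable (\<lambda>j. (x + real j) powr (-2))"
  proof (rule summable_comparison_test_ev)
    show "summable (\<lambda>j. real j powr (-2))" by (subst summable_real_powr_iff) auto
    show "eventually (\<lambda>j. norm ((x + real j) powr (-2)) \<le> real j powr (-2)) sequentially"
      using eventually_gt_at_top[of 0] by eventually_elim (use x in \<open>auto intro!: powr_mono2'\<close>)
  qed
  hence "summable g" unfolding g_def by (rule summable_mult)
  moreover have "g j \<ge> 0" for j using M by (simp add: g_def)
  moreover have "norm (em_step K t (y + real j)) \<le> norm (-t gchoose Suc K) * y powr (1 - Re t - real K) * g j"
    if t: "Re t \<ge> 1 - real K" and y: "y \<ge> x" for t y j
  proof -
    have "(y + real j) powr (- Re t - real K - 1) = (y + real j) powr (1 - Re t - real K) * (y + real j) powr (-2)"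
      by (simp add: powr_add [symmetric])
    also have "\<dots> \<le> y powr (1 - Re t - real K) * (x + real j) powr (-2)"
      using x y t by (intro mult_mono powr_mono2') auto
    finally have *: "(y + real j) powr (- Re t - real K - 1) \<le> \<dots>" .
    have "norm (em_step K t (y + real j)) \<le> M * norm (-t gchoose Suc K) * (y + real j) powr (- Re t - real K - 1)"
      using x y t by (intro M(2)) auto
    also have "\<dots> \<le> M * norm (-t gchoose Suc K) * (y powr (1 - Re t - real K) * (x + real j) powr (-2))"
      using M(1) by (intro mult_left_mono[OF *]) auto
    finally show ?thesis by (simp add: g_def mult_ac)
  qed
  ultimately show ?thesis by blast
qed

lemma continuous_on_gbinomial [continuous_intros]:
  fixes f :: "'a::topological_space \<Rightarrow> complex"
  assumes "continuous_on A f"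
  shows "continuous_on A (\<lambda>z. f z gchoose k)"
  unfolding gbinomial_prod_rev using assms by (intro continuous_intros) auto

lemma holomorphic_on_em_rem:
  assumes y: "y > 0"
  shows "(\<lambda>t. em_rem K t y) holomorphic_on {t. Re t > 1 - real K}"
proof -
  obtain g where g: "summable g" "\<And>j. g j \<ge> 0" "\<And>t j. Re t \<ge> 1 - real K \<Longrightarrow>
           norm (em_step K t (y + real j)) \<le> norm (-t gchoose Suc K) * y powr (1 - Re t - real K) * g j"
    using norm_em_step_shift_le[OF y, of K] by blast
  show ?thesis unfolding em_rem_def
  proof (rule holomorphic_on_suminf_majorised[where g = g and b = "\<lambda>t. norm (-t gchoose Suc K) * y powr (1 - Re t - real K)"])
    show "open {t. Re t > 1 - real K}" by (rule open_halfspace_Re_gt)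
    show "(\<lambda>t. em_step K t (y + real j)) holomorphic_on {t. Re t > 1 - real K}" for j
      using y by (intro holomorphic_on_em_step) auto
    show "continuous_on {t. Re t > 1 - real K} (\<lambda>t. norm (-t gchoose Suc K) * y powr (1 - Re t - real K))"
      using y by (intro continuous_intros) auto
  qed (use g in auto)
qed

lemma norm_em_rem_le:
  assumes x: "x > 0"
  shows "\<exists>M. \<forall>t y. Re t \<ge> 1 - real K \<longrightarrow> y \<ge> x \<longrightarrow>
           norm (em_rem K t y) \<le> M * norm (-t gchoose Suc K) * y powr (1 - Re t - real K)"
proof -
  obtain g where g: "summable g" "\<And>j. g j \<ge> 0" "\<And>t y j. Re t \<ge> 1 - real K \<Longrightarrow> y \<ge> x \<Longrightarrow>
           norm (em_step K t (y + real j)) \<le> norm (-t gchoose Suc K) * y powr (1 - Re t - real K) * g j"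
    using norm_em_step_shift_le[OF x, of K] by blast
  show ?thesis
  proof (intro exI[of _ "suminf g"] allI impI)
    fix t y assume "Re t \<ge> 1 - real K" "y \<ge> x"
    note * = g(3)[OF this]
    have "norm (em_rem K t y) \<le> (\<Sum>j. norm (-t gchoose Suc K) * y powr (1 - Re t - real K) * g j)"
      unfolding em_rem_def by (rule norm_suminf_le) (use * g(1) in \<open>auto intro!: summable_mult\<close>)
    also have "\<dots> = norm (-t gchoose Suc K) * y powr (1 - Re t - real K) * suminf g"
      using g(1) by (rule suminf_mult)
    finally show "norm (em_rem K t y) \<le> suminf g * norm (-t gchoose Suc K) * y powr (1 - Re t - real K)"
      by (simp add: mult_ac)
  qed
qed

lemma sums_em_rem:
  assumes y: "y > 0" and t: "Re t \<ge> 1 - real K"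
  shows "(\<lambda>j. em_step K t (y + real j)) sums em_rem K t y"
proof -
  obtain g where g: "summable g" "\<And>j. norm (em_step K t (y + real j)) \<le> norm (-t gchoose Suc K) * y powr (1 - Re t - real K) * g j"
    using norm_em_step_shift_le[OF y, of K] t by blast
  have "summable (\<lambda>j. em_step K t (y + real j))"
    by (rule summable_comparison_test[OF _ summable_mult[OF g(1)]]) (use g(2) in auto)
  thus ?thesis unfolding em_rem_def by (rule summable_sums)
qed

text \<open>The differences Q(y+j) - Q(y+j+1) telescope to Q(y), because every exponent in Q has
  negative real part when \<open>Re t > 1\<close>. Adding the defects \<open>em_step\<close> turns
  them into the terms of the series, which starts at \<open>y + 1\<close>.\<close>

lemma sums_hurwitz:
  assumes y: "y > 0" and t: "Re t > 1"
  shows "(\<lambda>n. of_real (y + real (Suc n)) powr (-t)) sums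
           (of_real y powr (1 - t) / (t - 1)
            + (\<Sum>k<K. (-t gchoose k) * zeta_neg k * of_real y powr (-t - of_nat k)) + em_rem K t y)"
proof -
  define Q where "Q = (\<lambda>y::real. of_real y powr (1 - t) / (t - 1)
            + (\<Sum>k<K. (-t gchoose k) * zeta_neg k * of_real y powr (-t - of_nat k)))"
  have step: "em_step K t u = of_real (u + 1) powr (-t) - (Q u - Q (u + 1))" for u
  proof -
    have "t \<noteq> 1" using t by auto
    hence "powr_integral (1 - t) u = of_real u powr (1 - t) / (t - 1) - of_real (u + 1) powr (1 - t) / (t - 1)"
      by (simp add: powr_integral_def divide_simps) (simp add: algebra_simps)
    thus ?thesis by (simp add: em_step_def Q_def algebra_simps sum_subtractf)
  qed
  have lim: "(\<lambda>n. of_real (y + real n) powr s) \<longlonglongrightarrow> (0::complex)" if "Re s < 0" for s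
  proof (rule tendsto_neg_powr_complex_of_real[OF _ that])
    show "filterlim (\<lambda>n. y + real n) at_top sequentially"
      by (rule filterlim_tendsto_add_at_top[OF tendsto_const filterlim_real_sequentially])
  qed
  have "(\<lambda>n. Q (y + real n)) \<longlonglongrightarrow> 0 / (t - 1) + (\<Sum>k<K. (-t gchoose k) * zeta_neg k * 0)"
    unfolding Q_def using t by (intro tendsto_intros lim) auto
  hence "(\<lambda>n. Q (y + real n)) \<longlonglongrightarrow> 0" by simp
  from telescope_sums'[OF this] have "(\<lambda>n. Q (y + real n) - Q (y + real (Suc n))) sums Q y" by simp
  moreover have "(\<lambda>j. em_step K t (y + real j)) sums em_rem K t y"
    using y t by (intro sums_em_rem) auto
  ultimately have "(\<lambda>j. Q (y + real j) - Q (y + real (Suc j)) + em_step K t (y + real j)) sums (Q y + em_rem K t y)"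
    by (intro sums_add)
  moreover have "Q (y + real j) - Q (y + real (Suc j)) + em_step K t (y + real j)
                    = of_real (y + real (Suc j)) powr (-t)" for j
    by (simp add: step add_ac)
  ultimately show ?thesis by (simp add: Q_def)
qed

section \<open>Hurwitz-type series weighted by a power of the summation index\<close>

text \<open>Follows \<open>n^(a+1) (n+y)^(-t) = n^a (n+y)^(-(t-1)) - y n^a (n+y)^(-t)\<close>.\<close>

primrec em_rem_pow :: "nat \<Rightarrow> nat \<Rightarrow> complex \<Rightarrow> real \<Rightarrow> complex" where
  "em_rem_pow K 0 t y = em_rem K t y"
| "em_rem_pow K (Suc a) t y = em_rem_pow K a (t - 1) y - of_real y * em_rem_pow K a t y"

text \<open>The Beta value B(a+1, t-a-1), that is, for \<open>Re t > a + 1\<close>, the integral of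
  u^a (1+u)^(-t) over the positive half-line; rescaling \<open>u\<close> by \<open>y\<close>
  produces the factor y^(a+1-t).\<close>

definition em_lead :: "nat \<Rightarrow> complex \<Rightarrow> complex" where
  "em_lead a t = fact a / (\<Prod>j=1..Suc a. t - of_nat j)"

text \<open>The counterpart for Beta integrals of the recursion of \<open>em_rem_pow\<close>,
  reflecting u^(a+1) (1+u)^(-t) = u^a (1+u)^(1-t) - u^a (1+u)^(-t). In the proof \<open>P\<close>
  collects the linear factors common to all three denominators.\<close>

lemma em_lead_Suc:
  assumes "\<And>j. j \<le> a + 2 \<Longrightarrow> t \<noteq> of_nat j"
  shows "em_lead (Suc a) t = em_lead a (t - 1) - em_lead a t"
proof -
  define P where "P = (\<Prod>j=2..Suc a. t - of_nat j)"
  have "t - of_nat j \<noteq> 0" if "j \<in> {2..Suc a}" for j using assms[of j] that by simp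
  hence "P \<noteq> 0" unfolding P_def by (subst prod_zero_iff) blast+
  have "(\<Prod>j=1..Suc a. t - 1 - of_nat j) = (\<Prod>j=2..Suc (Suc a). t - of_nat j)"
    by (rule prod.reindex_bij_witness[of _ "\<lambda>j. j - 1" Suc]) auto
  also have "\<dots> = P * (t - of_nat (a + 2))" by (simp add: P_def)
  finally have 1: "(\<Prod>j=1..Suc a. t - 1 - of_nat j) = P * (t - of_nat (a + 2))" .
  have 2: "(\<Prod>j=1..Suc a. t - of_nat j) = (t - 1) * P"
    unfolding P_def by (subst prod.atLeast_Suc_atMost) (auto simp: numeral_2_eq_2)
  have 3: "(\<Prod>j=1..Suc (Suc a). t - of_nat j) = (t - 1) * P * (t - of_nat (a + 2))"
    by (subst prod.nat_ivl_Suc') (use 2 in \<open>auto simp: mult_ac\<close>)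
  have "t - 1 \<noteq> 0" "t - of_nat (a + 2) \<noteq> 0"
    using assms[of 1] assms[of "a + 2"] by (auto simp del: of_nat_add)
  thus ?thesis using \<open>P \<noteq> 0\<close>
    unfolding em_lead_def 1 2 3 by (simp add: divide_simps) (simp add: algebra_simps)
qed

text \<open>Induction on \<open>a\<close> through n^(a+1) (n+y)^(-t) = n^a (n+y)^(1-t) - y n^a
  (n+y)^(-t). The two \<open>k = 0\<close> corrections cancel, and Pascal's rule combines the rest
  into \<open>-t gchoose k\<close>. Each step thus raises the index of \<open>zeta_neg\<close> by
  one and shortens the sum by one.\<close>

lemma sums_power_hurwitz:
  assumes y: "y > 0" and t: "Re t > real a + 1" and K: "a \<le> K"
  shows "(\<lambda>n. of_nat (Suc n) ^ a * of_real (y + real (Suc n)) powr (-t)) sums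
           (em_lead a t * of_real y powr (of_nat (Suc a) - t)
            + (\<Sum>k<K-a. (-t gchoose k) * zeta_neg (a + k) * of_real y powr (-t - of_nat k))
            + em_rem_pow K a t y)"
  using t K
proof (induction a arbitrary: t)
  case 0
  thus ?case using sums_hurwitz[OF y, of t K] by (simp add: em_lead_def)
next
  case (Suc a)
  define L where "L = K - Suc a"
  have L: "K - a = Suc L" using Suc.prems by (simp add: L_def)
  define p where "p = (\<lambda>k. of_real y powr (-t - of_nat k) :: complex)"
  have nz: "of_real y \<noteq> (0::complex)" using y by simp
  have yp: "of_real y * of_real y powr z = (of_real y powr (z + 1) :: complex)" for z
    using nz by (simp add: powr_add)
  have "t \<noteq> of_nat j" if "j \<le> a + 2" for j
    using that Suc.prems by (intro notI) simp
  hence lead: "em_lead (Suc a) t = em_lead a (t - 1) - em_lead a t"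
    by (rule em_lead_Suc)
  have "(\<lambda>n. of_nat (Suc n) ^ a * of_real (y + real (Suc n)) powr (-(t - 1))
             - of_real y * (of_nat (Suc n) ^ a * of_real (y + real (Suc n)) powr (-t))) sums
          ((em_lead a (t - 1) * of_real y powr (of_nat (Suc a) - (t - 1))
            + (\<Sum>k<K-a. (-(t - 1) gchoose k) * zeta_neg (a + k) * of_real y powr (-(t - 1) - of_nat k))
            + em_rem_pow K a (t - 1) y)
          - of_real y * (em_lead a t * of_real y powr (of_nat (Suc a) - t)
            + (\<Sum>k<K-a. (-t gchoose k) * zeta_neg (a + k) * of_real y powr (-t - of_nat k))
            + em_rem_pow K a t y))" (is "?f sums ?S")
    using Suc.prems by (intro sums_diff sums_mult Suc.IH) auto
  also have "?f = (\<lambda>n. of_nat (Suc n) ^ Suc a * of_real (y + real (Suc n)) powr (-t))"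
  proof
    fix n
    have "of_real (y + real (Suc n)) \<noteq> (0::complex)" using y by (subst of_real_eq_0_iff) auto
    hence "of_real (y + real (Suc n)) powr (-(t - 1)) = of_real (y + real (Suc n)) * of_real (y + real (Suc n)) powr (-t)"
      using powr_add[of "of_real (y + real (Suc n)) :: complex" 1 "-t"] by (simp del: of_nat_Suc)
    thus "?f n = of_nat (Suc n) ^ Suc a * of_real (y + real (Suc n)) powr (-t)"
      by (simp add: algebra_simps)
  qed
  also have "?S = em_lead (Suc a) t * of_real y powr (of_nat (Suc (Suc a)) - t)
            + (\<Sum>k<K - Suc a. (-t gchoose k) * zeta_neg (Suc a + k) * of_real y powr (-t - of_nat k))
            + em_rem_pow K (Suc a) t y"
  proof -
    have 1: "(\<Sum>k<K-a. (-(t - 1) gchoose k) * zeta_neg (a + k) * of_real y powr (-(t - 1) - of_nat k))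
       = zeta_neg a * (of_real y * p 0) + (\<Sum>k<L. (1 - t gchoose Suc k) * zeta_neg (a + Suc k) * p k)"
      unfolding L sum.lessThan_Suc_shift by (simp add: p_def yp algebra_simps)
    have 2: "of_real y * (\<Sum>k<K-a. (-t gchoose k) * zeta_neg (a + k) * of_real y powr (-t - of_nat k))
       = zeta_neg a * (of_real y * p 0) + (\<Sum>k<L. (-t gchoose Suc k) * zeta_neg (a + Suc k) * (of_real y * p (Suc k)))"
      unfolding L sum.lessThan_Suc_shift by (simp add: p_def sum_distrib_left algebra_simps)
    have 3: "of_real y * p (Suc k) = p k" for k by (simp add: p_def yp algebra_simps)
    have 4: "(1 - t gchoose Suc k) = (-t gchoose k) + (-t gchoose Suc k)" for k
      using gbinomial_Suc_Suc[of "-t" k] by (simp add: algebra_simps)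
    have 5: "of_real y powr (of_nat (Suc a) - (t - 1)) = (of_real y powr (of_nat (Suc (Suc a)) - t) :: complex)"
      by (simp add: algebra_simps)
    have 6: "of_real y * (em_lead a t * of_real y powr (of_nat (Suc a) - t)) =
             em_lead a t * of_real y powr (of_nat (Suc (Suc a)) - t)"
      using yp[of "of_nat (Suc a) - t"] by (simp add: algebra_simps)
    show ?thesis
      unfolding distrib_left 1 2 3 4 5 6 lead L_def [symmetric]
      by (simp add: p_def algebra_simps sum.distrib)
  qed
  finally show ?case .
qed

lemma holomorphic_on_em_rem_pow:
  assumes y: "y > 0"
  shows "(\<lambda>t. em_rem_pow K a t y) holomorphic_on {t. Re t > 1 + real a - real K}"
proof (induction a)
  case 0
  thus ?case using holomorphic_on_em_rem[OF y, of K] by simp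
next
  case (Suc a)
  have "((\<lambda>t. em_rem_pow K a t y) \<circ> (\<lambda>t. t - 1)) holomorphic_on {t. Re t > 1 + real (Suc a) - real K}"
    by (rule holomorphic_on_compose_gen[OF _ Suc.IH]) (auto intro!: holomorphic_intros)
  moreover have "(\<lambda>t. em_rem_pow K a t y) holomorphic_on {t. Re t > 1 + real (Suc a) - real K}"
    by (rule holomorphic_on_subset[OF Suc.IH]) auto
  ultimately show ?case by (auto simp: o_def intro!: holomorphic_intros)
qed

text \<open>Each step of the recursion, whether by the shift to \<open>t - 1\<close> or by the
  factor \<open>y\<close>, costs one power of \<open>y\<close>. For the \<open>t\<close>-dependence
  only continuity of \<open>b\<close> is retained, which is what the M-test asks for.\<close>

lemma norm_em_rem_pow_le:
  assumes x: "x > 0"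
  shows "\<exists>b. continuous_on UNIV b \<and> (\<forall>t y. Re t \<ge> 1 + real a - real K \<longrightarrow> y \<ge> x \<longrightarrow>
           norm (em_rem_pow K a t y) \<le> b t * y powr (1 + real a - Re t - real K))"
proof (induction a)
  case 0
  obtain M where M: "\<And>t y. Re t \<ge> 1 - real K \<Longrightarrow> y \<ge> x \<Longrightarrow>
           norm (em_rem K t y) \<le> M * norm (-t gchoose Suc K) * y powr (1 - Re t - real K)"
    using norm_em_rem_le[OF x, of K] by blast
  have "continuous_on UNIV (\<lambda>t::complex. M * norm (-t gchoose Suc K))"
    by (intro continuous_intros)
  thus ?case using M by (intro exI[of _ "\<lambda>t. M * norm (-t gchoose Suc K)"]) auto
next
  case (Suc a)
  then obtain b where b: "continuous_on UNIV b" "\<And>t y. Re t \<ge> 1 + real a - real K \<Longrightarrow> y \<ge> x \<Longrightarrow>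
           norm (em_rem_pow K a t y) \<le> b t * y powr (1 + real a - Re t - real K)" by blast
  have "continuous_on UNIV (\<lambda>t. b (t - 1) + b t)"
    using b(1) by (auto intro!: continuous_intros continuous_on_compose2[OF b(1)])
  moreover have "norm (em_rem_pow K (Suc a) t y) \<le> (b (t - 1) + b t) * y powr (1 + real (Suc a) - Re t - real K)"
    if t: "Re t \<ge> 1 + real (Suc a) - real K" and y: "y \<ge> x" for t y
  proof -
    have "norm (em_rem_pow K (Suc a) t y) \<le> norm (em_rem_pow K a (t - 1) y) + y * norm (em_rem_pow K a t y)"
      using norm_triangle_ineq4[of "em_rem_pow K a (t - 1) y" "of_real y * em_rem_pow K a t y"] x y
      by (simp add: norm_mult)
    also have "\<dots> \<le> b (t - 1) * y powr (1 + real a - Re (t - 1) - real K)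
                    + y * (b t * y powr (1 + real a - Re t - real K))"
      using t y x by (intro add_mono mult_left_mono b(2)) auto
    also have "y * (b t * y powr (1 + real a - Re t - real K)) = b t * (y powr 1 * y powr (1 + real a - Re t - real K))"
      using x y by simp
    finally show ?thesis by (simp only: powr_add [symmetric]) (simp add: algebra_simps)
  qed
  ultimately show ?case by blast
qed

text \<open>The recursion evaluates \<open>em_rem\<close> only at \<open>-N\<close>, ...,
  \<open>-(N+a)\<close>. For \<open>N + a < K\<close> these points lie in the half plane of the
  estimate, and there \<open>-t gchoose Suc K\<close> is zero.\<close>

lemma em_rem_pow_neg_of_nat:
  assumes y: "y > 0" and N: "N + a < K"
  shows "em_rem_pow K a (- of_nat N) y = 0"
  using N
proof (induction a arbitrary: N)
  case 0
  obtain M where M: "\<And>t. Re t \<ge> 1 - real K \<Longrightarrow>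
           norm (em_rem K t y) \<le> M * norm (-t gchoose Suc K) * y powr (1 - Re t - real K)"
    using norm_em_rem_le[OF y, of K] by blast
  have "(of_nat N gchoose Suc K) = (0::complex)"
    using 0 by (simp add: binomial_gbinomial [symmetric] del: of_nat_Suc)
  thus ?case using M[of "- of_nat N"] 0 by simp
next
  case (Suc a)
  have "- of_nat N - 1 = (- of_nat (Suc N) :: complex)" by simp
  thus ?case using Suc.IH[of N] Suc.IH[of "Suc N"] Suc.prems by (simp del: of_nat_Suc)
qed

section \<open>The Riemann zeta function\<close>

text \<open>An open half plane stays connected after a countable set is removed, so agreement far to
  the right propagates past the exceptional points.\<close>

lemma half_plane_identity:
  fixes f g :: "complex \<Rightarrow> complex"
  assumes "f holomorphic_on {t. Re t > c} - A" "g holomorphic_on {t. Re t > c} - A"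
    and A: "closed A" "countable A"
    and eq: "\<And>t. Re t > d \<Longrightarrow> t \<notin> A \<and> f t = g t"
    and t: "Re t > c" "t \<notin> A"
  shows "f t = g t"
proof (rule analytic_continuation_open[where f = f and g = g and s = "{t. Re t > max c d}" and s' = "{t. Re t > c} - A"])
  show "open {t. Re t > max c d}" by (rule open_halfspace_Re_gt)
  show "open ({t. Re t > c} - A)" using A by (intro open_Diff open_halfspace_Re_gt)
  have "complex_of_real (max c d + 1) \<in> {t. Re t > max c d}" by (simp add: max_def)
  thus "{t. Re t > max c d} \<noteq> {}" by blast
  show "connected ({t. Re t > c} - A)"
    using A by (intro connected_open_diff_countable open_halfspace_Re_gt convex_connected
                      convex_halfspace_Re_gt) auto
qed (use assms in auto)

lemma sums_zeta_series:
  assumes "Re s > 1"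
  shows "(\<lambda>n. of_nat (Suc n) powr (-s)) sums (\<Sum>\<^sub>\<infinity>n\<in>{1::nat..}. 1 / of_nat n powr s)"
proof -
  have "summable (\<lambda>n. real n powr (- Re s))" using assms by (subst summable_real_powr_iff) auto
  hence "summable (\<lambda>n. real (Suc n) powr (- Re s))" by (subst summable_Suc_iff)
  also have "(\<lambda>n. real (Suc n) powr (- Re s)) = (\<lambda>n. norm (of_nat (Suc n) powr (-s) :: complex))"
    by (subst norm_powr_real_powr) auto
  finally have "(\<lambda>n. of_nat (Suc n) powr (-s) :: complex) summable_on UNIV"
    by (rule norm_summable_imp_summable_on)
  hence "((\<lambda>n. of_nat (Suc n) powr (-s)) has_sum (\<Sum>\<^sub>\<infinity>n. of_nat (Suc n) powr (-s) :: complex)) UNIV"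
    by (rule has_sum_infsum)
  hence "(\<lambda>n. of_nat (Suc n) powr (-s)) sums (\<Sum>\<^sub>\<infinity>n. of_nat (Suc n) powr (-s) :: complex)"
    by (rule has_sum_imp_sums)
  also have "(\<Sum>\<^sub>\<infinity>n. of_nat (Suc n) powr (-s) :: complex) = (\<Sum>\<^sub>\<infinity>n\<in>{1::nat..}. 1 / of_nat n powr s)"
    by (rule infsum_reindex_bij_witness[of _ "\<lambda>n. n - 1" Suc]) (auto simp: powr_minus field_simps)
  finally show ?thesis .
qed

text \<open>The right-hand side of \<open>sums_hurwitz\<close> at \<open>y = 1\<close>, where all
  powers of \<open>y\<close> equal 1. That series begins at \<open>n = 2\<close>; the leading 1
  restores the term \<open>n = 1\<close>.\<close>

definition zeta_em :: "nat \<Rightarrow> complex \<Rightarrow> complex" where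
  "zeta_em K t = 1 + 1 / (t - 1) + (\<Sum>k<K. (-t gchoose k) * zeta_neg k) + em_rem K t 1"

lemma holomorphic_on_zeta_em: "zeta_em K holomorphic_on {t. Re t > 1 - real K} - {1}"
proof -
  have "(\<lambda>t. em_rem K t 1) holomorphic_on {t. Re t > 1 - real K} - {1}"
    by (rule holomorphic_on_subset[OF holomorphic_on_em_rem]) auto
  thus ?thesis unfolding zeta_em_def[abs_def] by (intro holomorphic_intros) auto
qed

lemma zeta_em_series:
  assumes "Re t > 1"
  shows "zeta_em K t = (\<Sum>\<^sub>\<infinity>n\<in>{1::nat..}. 1 / of_nat n powr t)"
proof -
  have "(\<lambda>n. of_real (1 + real (Suc n)) powr (-t)) sums
           (of_real 1 powr (1 - t) / (t - 1)
            + (\<Sum>k<K. (-t gchoose k) * zeta_neg k * of_real 1 powr (-t - of_nat k)) + em_rem K t 1)"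
    by (rule sums_hurwitz) (use assms in auto)
  hence "(\<lambda>n. of_nat (Suc (Suc n)) powr (-t)) sums (zeta_em K t - of_nat (Suc 0) powr (-t))"
    by (simp add: zeta_em_def add_ac)
  hence "(\<lambda>n. of_nat (Suc n) powr (-t)) sums zeta_em K t"
    using sums_Suc_iff[of "\<lambda>n. of_nat (Suc n) powr (-t)" "zeta_em K t - of_nat (Suc 0) powr (-t)"]
    by (simp del: of_nat_Suc)
  thus ?thesis using sums_zeta_series[OF assms] by (rule sums_unique2)
qed

lemma zeta_em_unique:
  assumes "Re t > 1 - real K" "Re t > 1 - real L" "t \<noteq> 1"
  shows "zeta_em K t = zeta_em L t"
proof (rule half_plane_identity[where f = "zeta_em K" and g = "zeta_em L" and c = "1 - real (min K L)" and d = 1 and A = "{1}"])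
  show "zeta_em K holomorphic_on {t. Re t > 1 - real (min K L)} - {1}"
    by (rule holomorphic_on_subset[OF holomorphic_on_zeta_em]) auto
  show "zeta_em L holomorphic_on {t. Re t > 1 - real (min K L)} - {1}"
    by (rule holomorphic_on_subset[OF holomorphic_on_zeta_em]) auto
  show "s \<notin> {1} \<and> zeta_em K s = zeta_em L s" if "Re s > 1" for s
    using that by (auto simp: zeta_em_series)
qed (use assms in \<open>auto simp: min_def\<close>)

text \<open>A witness for the choice operator in \<open>riemann_zeta\<close>: the functions
  \<open>zeta_em K\<close> agree where their half planes overlap and are glued by letting the order
  grow with the norm of \<open>t\<close>.\<close>

lemma riemann_zeta_exists:
  "\<exists>f. f holomorphic_on (- {1}) \<and>
       (\<forall>s. Re s > 1 \<longrightarrow> f s = (\<Sum>\<^sub>\<infinity>n\<in>{1::nat..}. 1 / of_nat n powr s))"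
proof (intro exI conjI allI impI)
  let ?f = "\<lambda>t. zeta_em (nat \<lceil>norm t\<rceil> + 2) t"
  have gt: "Re t > 1 - real (nat \<lceil>norm t\<rceil> + 2)" for t :: complex
    using abs_Re_le_cmod[of t] by linarith
  show "?f holomorphic_on (- {1})"
  proof (subst holomorphic_on_open)
    show "\<forall>t\<in>- {1}. \<exists>f'. (?f has_field_derivative f') (at t)"
    proof
      fix t :: complex assume t: "t \<in> - {1}"
      define K where "K = nat \<lceil>norm t\<rceil> + 2"
      \<comment> \<open>The order is frozen at the value belonging to \<open>t\<close>. On this
        neighbourhood the glued function coincides with the single \<open>zeta_em K\<close>,
        although its own order varies with the point.\<close>
      define U where "U = {t. Re t > 1 - real K} - {1}"
      have U: "open U" unfolding U_def by (intro open_Diff open_halfspace_Re_gt) auto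
      have tU: "t \<in> U" using gt[of t] t by (simp add: U_def K_def)
      obtain f' where "(zeta_em K has_field_derivative f') (at t)"
        using holomorphic_on_zeta_em[of K] U tU holomorphic_on_open unfolding U_def by blast
      hence "(?f has_field_derivative f') (at t)"
      proof (rule has_field_derivative_transform_within_open[OF _ U tU])
        show "zeta_em K s = ?f s" if "s \<in> U" for s
          using that gt[of s] by (intro zeta_em_unique) (auto simp: U_def)
      qed
      thus "\<exists>f'. (?f has_field_derivative f') (at t)" ..
    qed
  qed auto
  show "?f s = (\<Sum>\<^sub>\<infinity>n\<in>{1::nat..}. 1 / of_nat n powr s)" if "Re s > 1" for s
    using that by (rule zeta_em_series)
qed

lemma holomorphic_on_riemann_zeta: "riemann_zeta holomorphic_on (- {1})"
  and riemann_zeta_series: "Re s > 1 \<Longrightarrow> riemann_zeta s = (\<Sum>\<^sub>\<infinity>n\<in>{1::nat..}. 1 / of_nat n powr s)"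
  using someI_ex[OF riemann_zeta_exists] unfolding riemann_zeta_def by blast+

lemma riemann_zeta_eq_zeta_em:
  assumes "Re t > 1 - real K" "t \<noteq> 1"
  shows "riemann_zeta t = zeta_em K t"
proof (rule half_plane_identity[where f = riemann_zeta and g = "zeta_em K" and c = "1 - real K" and d = 1 and A = "{1}"])
  show "riemann_zeta holomorphic_on {t. Re t > 1 - real K} - {1}"
    by (rule holomorphic_on_subset[OF holomorphic_on_riemann_zeta]) auto
  show "s \<notin> {1} \<and> riemann_zeta s = zeta_em K s" if "Re s > 1" for s
    using that by (auto simp: zeta_em_series riemann_zeta_series)
qed (use assms holomorphic_on_zeta_em in auto)

lemma sums_riemann_zeta:
  "Re s > 1 \<Longrightarrow> (\<lambda>n. of_nat (Suc n) powr (-s)) sums riemann_zeta s"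
  using sums_zeta_series riemann_zeta_series by simp

text \<open>At \<open>-n\<close> the remainder vanishes and the binomials with \<open>k > n\<close>
  are zero. The recursion cancels 1 - 1/(n+1) against the terms with \<open>k < n\<close>, leaving
  the term \<open>k = n\<close>.\<close>

lemma riemann_zeta_neg_of_nat: "riemann_zeta (- of_nat n) = zeta_neg n"
proof -
  define K where "K = n + 2"
  have "riemann_zeta (- of_nat n) = zeta_em K (- of_nat n)"
  proof (rule riemann_zeta_eq_zeta_em)
    show "- of_nat n \<noteq> (1::complex)" by (metis of_nat_Suc of_nat_neq_0 add.commute add.right_inverse)
  qed (simp add: K_def)
  also have "\<dots> = 1 - 1 / of_nat (Suc n) + (\<Sum>k<K. (of_nat n gchoose k) * zeta_neg k)"
  proof -
    have "- of_nat n - 1 = - (of_nat (Suc n) :: complex)" by simp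
    moreover have "em_rem K (- of_nat n) 1 = 0"
      using em_rem_pow_neg_of_nat[of 1 n 0 K] by (simp add: K_def)
    ultimately show ?thesis by (simp add: zeta_em_def del: of_nat_Suc)
  qed
  also have "(\<Sum>k<K. (of_nat n gchoose k) * zeta_neg k) = (\<Sum>k<n. of_nat (n choose k) * zeta_neg k) + zeta_neg n"
    by (simp add: K_def numeral_2_eq_2 binomial_gbinomial [symmetric])
  finally show ?thesis by (simp add: sum_choose_zeta_neg)
qed

text \<open>Order \<open>K = 1\<close> isolates the pole. At \<open>t = 1\<close> the remainder is
  the Euler series for \<open>euler_mascheroni\<close> plus a telescoping series worth
  -(\<open>zeta_neg 0\<close> + 1), which offsets the explicit constant of
  \<open>?h\<close>.\<close>

lemma riemann_zeta_laurent_1: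
  obtains h where "h holomorphic_on {t. Re t > 0}" "h 1 = euler_mascheroni"
    "\<And>t. Re t > 0 \<Longrightarrow> t \<noteq> 1 \<Longrightarrow> riemann_zeta t = 1 / (t - 1) + h t"
proof
  let ?h = "\<lambda>t. 1 + zeta_neg 0 + em_rem 1 t 1"
  show "?h holomorphic_on {t. Re t > 0}"
    using holomorphic_on_em_rem[of 1 1] by (auto intro!: holomorphic_intros)
  show "riemann_zeta t = 1 / (t - 1) + ?h t" if "Re t > 0" "t \<noteq> 1" for t
    using riemann_zeta_eq_zeta_em[of 1 t] that by (simp add: zeta_em_def)
  \<comment> \<open>The reciprocal 1/(j+2) is traded for 1/(j+1) to match
    \<open>euler_mascheroni_sum\<close>; the difference of the two is absorbed in the telescoping
    part.\<close>
  have step: "em_step 1 1 (1 + real j) = (inverse (of_nat (j + 1)) + of_real (ln (of_nat (j+1))) - of_real (ln (of_nat (j+2))))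
      + (zeta_neg 0 + 1) * (inverse (of_nat (Suc (Suc j))) - inverse (of_nat (Suc j)))" for j
  proof -
    have p: "of_real (1 + real j + 1) powr (-1) = inverse (of_nat (j + 2) :: complex)"
            "of_real (1 + real j) powr (-1) = inverse (of_nat (j + 1) :: complex)"
      by (simp_all add: powr_minus add_ac)
    have l: "ln (1 + real j + 1) = ln (of_nat (j + 2))" "ln (1 + real j) = ln (of_nat (j + 1))"
      by (simp_all add: add_ac)
    have "em_step 1 1 (1 + real j) = of_real (1 + real j + 1) powr (-1)
        - (of_real (ln (1 + real j + 1)) - of_real (ln (1 + real j)))
        + zeta_neg 0 * (of_real (1 + real j + 1) powr (-1) - of_real (1 + real j) powr (-1))"
      by (simp add: em_step_def powr_integral_def del: of_real_add)
    also have "\<dots> = (inverse (of_nat (j + 1)) + of_real (ln (of_nat (j+1))) - of_real (ln (of_nat (j+2))))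
      + (zeta_neg 0 + 1) * (inverse (of_nat (j + 2)) - inverse (of_nat (j + 1)))"
    proof -
      have "b - (m - l) + z * (b - a) = a + l - m + (z + 1) * (b - a)" for a b l m z :: complex
        by (simp add: algebra_simps)
      thus ?thesis unfolding p l .
    qed
    finally show ?thesis by simp
  qed
  have "(\<lambda>j. inverse (of_nat (Suc j)) :: complex) \<longlonglongrightarrow> 0"
    by (rule lim_inverse_n[THEN LIMSEQ_Suc])
  hence "(\<lambda>j. inverse (of_nat (Suc (Suc j))) - inverse (of_nat (Suc j)) :: complex) sums (0 - inverse (of_nat (Suc 0)))"
    by (rule telescope_sums)
  hence "(\<lambda>j. em_step 1 1 (1 + real j)) sums (euler_mascheroni + (zeta_neg 0 + 1) * (0 - inverse (of_nat (Suc 0))))"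
    unfolding step by (intro sums_add sums_mult euler_mascheroni_sum)
  moreover have "(\<lambda>j. em_step 1 1 (1 + real j)) sums em_rem 1 1 1"
    by (rule sums_em_rem) auto
  ultimately have "em_rem 1 1 1 = euler_mascheroni + (zeta_neg 0 + 1) * (0 - inverse (of_nat (Suc 0)))"
    using sums_unique2 by blast
  thus "?h 1 = euler_mascheroni" by simp
qed

section \<open>The double series\<close>

lemma summable_on_from_1_imp_sums:
  fixes f :: "nat \<Rightarrow> 'a :: {comm_monoid_add, t2_space}"
  assumes "f summable_on {1..}"
  shows "(\<lambda>n. f (Suc n)) sums (\<Sum>\<^sub>\<infinity>n\<in>{1..}. f n)"
proof (rule has_sum_imp_sums)
  have "(f has_sum (\<Sum>\<^sub>\<infinity>n\<in>{1..}. f n)) {1..}"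
    using assms by (rule has_sum_infsum)
  also have "?this \<longleftrightarrow> ((\<lambda>n. f (Suc n)) has_sum (\<Sum>\<^sub>\<infinity>n\<in>{1..}. f n)) UNIV"
    by (rule has_sum_reindex_bij_witness[of _ Suc "\<lambda>n. n - 1"]) auto
  finally show "((\<lambda>n. f (Suc n)) has_sum (\<Sum>\<^sub>\<infinity>n\<in>{1..}. f n)) UNIV" .
qed

lemma summable_on_Times_inverse_squares:
  "(\<lambda>(n, m). real n powr (-2) * real m powr (-2)) summable_on {1::nat..} \<times> {1::nat..}"
proof -
  have "summable (\<lambda>n. real n powr (-2))" by (subst summable_real_powr_iff) auto
  hence "(\<lambda>n. real n powr (-2)) summable_on UNIV"
    by (intro norm_summable_imp_summable_on) simp
  hence *: "(\<lambda>n. real n powr (-2)) summable_on {1..}" by (rule summable_on_subset) auto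
  show ?thesis
  proof (rule summable_on_SigmaI)
    show "((\<lambda>m. case (n, m) of (n, m) \<Rightarrow> real n powr (-2) * real m powr (-2)) has_sum
            real n powr (-2) * (\<Sum>\<^sub>\<infinity>m\<in>{1..}. real m powr (-2))) {1..}" for n :: nat
      using * by (auto intro!: has_sum_cmult_right has_sum_infsum)
    show "(\<lambda>n. real n powr (-2) * (\<Sum>\<^sub>\<infinity>m\<in>{1..}. real m powr (-2))) summable_on {1..}"
      using * by (rule summable_on_cmult_left)
  qed auto
qed

definition MT_term :: "real \<Rightarrow> nat \<Rightarrow> complex \<Rightarrow> complex \<Rightarrow> nat \<Rightarrow> nat \<Rightarrow> complex" where
  "MT_term x a s t n m = of_nat m powr (-s) * (of_nat n ^ a * of_real (x * real m + real n) powr (-t))"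

lemma MT_term_summable:
  assumes x: "x > 0" and t: "Re t \<ge> real a + 2" "Re s + Re t \<ge> real a + 4"
  shows "(\<lambda>(n, m). MT_term x a s t n m) summable_on {1..} \<times> {1..}"
proof (rule Infinite_Sum.abs_summable_summable, rule Infinite_Sum.abs_summable_on_comparison_test')
  \<comment> \<open>Of the exponent \<open>Re t\<close>, the part \<open>a + 2\<close> is spent on
    \<open>n\<close> and leaves n^(-2) after the factor n^a; the rest \<open>q\<close> is spent on
    \<open>m\<close>, where the second hypothesis gives \<open>Re s + q \<ge> 2\<close>.\<close>
  define q where "q = Re t - real a - 2"
  have q: "q \<ge> 0" "- Re s - q \<le> -2" "- Re t = (- real a - 2) + (- q)" using t by (auto simp: q_def)
  show "(\<lambda>u. x powr (-q) * (case u of (n, m) \<Rightarrow> real n powr (-2) * real m powr (-2))) summable_on {1::nat..} \<times> {1::nat..}"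
    by (intro summable_on_cmult_right summable_on_Times_inverse_squares)
  show "norm (case u of (n, m) \<Rightarrow> MT_term x a s t n m) \<le>
          x powr (-q) * (case u of (n, m) \<Rightarrow> real n powr (-2) * real m powr (-2))"
    if u: "u \<in> {1..} \<times> {1..}" for u
  proof -
    obtain n m where [simp]: "u = (n, m)" by (cases u)
    have n: "real n \<ge> 1" and m: "real m \<ge> 1" using u by auto
    have pos: "x * real m > 0" using x m by simp
    have "(x * real m + real n) powr (- Re t)
        = (x * real m + real n) powr (- real a - 2) * (x * real m + real n) powr (- q)"
      unfolding q(3) by (rule powr_add)
    also have "\<dots> \<le> real n powr (- real a - 2) * (x * real m) powr (- q)"
      using pos n q(1) by (intro mult_mono powr_mono2') auto
    finally have *: "(x * real m + real n) powr (- Re t) \<le> real n powr (- real a - 2) * (x * real m) powr (- q)" .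
    have "norm (of_real (x * real m + real n) powr (-t)) = (x * real m + real n) powr (- Re t)"
      using pos n by (subst norm_powr_real_powr) (auto simp del: of_real_add of_real_mult)
    moreover have "norm (of_nat m powr (-s)) = real m powr (- Re s)"
      using m by (subst norm_powr_real_powr) auto
    ultimately have "norm (MT_term x a s t n m) = real m powr (- Re s) * (real n ^ a * (x * real m + real n) powr (- Re t))"
      by (simp add: MT_term_def norm_mult norm_power)
    also have "\<dots> \<le> real m powr (- Re s) * (real n ^ a * (real n powr (- real a - 2) * (x * real m) powr (- q)))"
      by (intro mult_left_mono *) auto
    also have "\<dots> = x powr (-q) * ((real n ^ a * real n powr (- real a - 2)) * (real m powr (- Re s) * real m powr (-q)))"
      using x m by (simp add: powr_mult)
    also have "real n ^ a * real n powr (- real a - 2) = real n powr (-2)"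
      using n by (simp add: powr_realpow [symmetric] powr_add [symmetric])
    also have "real m powr (- Re s) * real m powr (-q) = real m powr (- Re s - q)"
      by (simp add: powr_add [symmetric])
    also have "\<dots> \<le> real m powr (-2)" using m q(2) by (intro powr_mono) auto
    finally show ?thesis using x by (simp add: mult_left_mono)
  qed
qed

lemma MT_series_eq_infsum_MT_term:
  assumes x: "x > 0"
  shows "MT_series x (- of_nat a) s t = (\<Sum>\<^sub>\<infinity>(n, m)\<in>{1..}\<times>{1..}. MT_term x a s t n m)"
  unfolding MT_series_def
proof (rule infsum_cong)
  fix u :: "nat \<times> nat" assume u: "u \<in> {1..} \<times> {1..}"
  obtain n m where [simp]: "u = (n, m)" by (cases u)
  have "of_nat n powr (of_nat a) = (of_nat n ^ a :: complex)"
    using u by (intro powr_nat') auto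
  thus "(case u of (n, m) \<Rightarrow> 1 / (of_nat n powr (- of_nat a) * of_nat m powr s *
            of_real (real n + real m * x) powr t)) = (case u of (n, m) \<Rightarrow> MT_term x a s t n m)"
    by (simp add: MT_term_def powr_minus field_simps)
qed

definition MT_rem :: "nat \<Rightarrow> nat \<Rightarrow> real \<Rightarrow> complex \<Rightarrow> complex \<Rightarrow> complex" where
  "MT_rem K a x s t = (\<Sum>m. of_nat (Suc m) powr (-s) * em_rem_pow K a t (x * real (Suc m)))"

definition MT_em :: "nat \<Rightarrow> nat \<Rightarrow> real \<Rightarrow> complex \<Rightarrow> complex \<Rightarrow> complex" where
  "MT_em K a x s t =
     em_lead a t * of_real x powr (of_nat (Suc a) - t) * riemann_zeta (s + t - of_nat (Suc a))
     + (\<Sum>k<K-a. (-t gchoose k) * zeta_neg (a + k) * of_real x powr (-t - of_nat k) * riemann_zeta (s + t + of_nat k))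
     + MT_rem K a x s t"

text \<open>Absolute summability allows summing over \<open>n\<close> before \<open>m\<close>. The
  hypotheses put every zeta argument to the right of 1, so each explicit power of
  \<open>x * m\<close> can be summed separately.\<close>

lemma MT_series_eq_MT_em:
  assumes x: "x > 0" and t: "Re t \<ge> real a + 2" "Re s + Re t \<ge> real a + 4" and K: "a \<le> K"
  shows "MT_series x (- of_nat a) s t = MT_em K a x s t"
proof -
  define S where "S = (\<lambda>y. em_lead a t * of_real y powr (of_nat (Suc a) - t)
            + (\<Sum>k<K-a. (-t gchoose k) * zeta_neg (a + k) * of_real y powr (-t - of_nat k))
            + em_rem_pow K a t y)"
  have summ: "(\<lambda>(n, m). MT_term x a s t n m) summable_on {1..} \<times> {1..}"
    using x t by (rule MT_term_summable)
  have "bij_betw prod.swap ({1::nat..} \<times> {1::nat..}) ({1..} \<times> {1..})"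
    by (auto simp: bij_betw_def inj_on_def image_iff)
  from summable_on_reindex_bij_betw[OF this, of "\<lambda>(n, m). MT_term x a s t n m"]
  have summ': "(\<lambda>(m, n). MT_term x a s t n m) summable_on {1..} \<times> {1..}"
    using summ by (simp add: case_prod_unfold)
  have inner: "(\<Sum>\<^sub>\<infinity>n\<in>{1..}. MT_term x a s t n m) = of_nat m powr (-s) * S (x * real m)" if "m \<ge> 1" for m
  proof -
    have "(\<lambda>n. MT_term x a s t n m) summable_on {1..}"
      using summable_on_SigmaD1[OF summ', of m] that by simp
    from summable_on_from_1_imp_sums[OF this]
    have "(\<lambda>n. MT_term x a s t (Suc n) m) sums (\<Sum>\<^sub>\<infinity>n\<in>{1..}. MT_term x a s t n m)" .
    moreover have "(\<lambda>n. MT_term x a s t (Suc n) m) sums (of_nat m powr (-s) * S (x * real m))"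
      unfolding MT_term_def S_def
      using x t K that by (intro sums_mult sums_power_hurwitz) auto
    ultimately show ?thesis by (rule sums_unique2)
  qed
  have "MT_series x (- of_nat a) s t = (\<Sum>\<^sub>\<infinity>(n, m)\<in>{1..}\<times>{1..}. MT_term x a s t n m)"
    by (rule MT_series_eq_infsum_MT_term[OF x])
  also have "\<dots> = (\<Sum>\<^sub>\<infinity>n\<in>{1..}. \<Sum>\<^sub>\<infinity>m\<in>{1..}. MT_term x a s t n m)"
    by (rule infsum_Sigma'_banach[OF summ, symmetric])
  also have "\<dots> = (\<Sum>\<^sub>\<infinity>m\<in>{1..}. \<Sum>\<^sub>\<infinity>n\<in>{1..}. MT_term x a s t n m)"
    by (rule infsum_swap_banach[OF summ])
  finally have "MT_series x (- of_nat a) s t = (\<Sum>\<^sub>\<infinity>m\<in>{1..}. \<Sum>\<^sub>\<infinity>n\<in>{1..}. MT_term x a s t n m)" .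
  moreover have "(\<lambda>m. \<Sum>\<^sub>\<infinity>n\<in>{1..}. MT_term x a s t n m) summable_on {1..}"
    using summable_on_Sigma_banach[OF summ'] by simp
  from summable_on_from_1_imp_sums[OF this]
  have "(\<lambda>m. of_nat (Suc m) powr (-s) * S (x * real (Suc m))) sums
          (\<Sum>\<^sub>\<infinity>m\<in>{1..}. \<Sum>\<^sub>\<infinity>n\<in>{1..}. MT_term x a s t n m)"
    by (subst (asm) inner) auto
  ultimately have A: "(\<lambda>m. of_nat (Suc m) powr (-s) * S (x * real (Suc m))) sums MT_series x (- of_nat a) s t"
    by simp
  have powr_split: "of_nat (Suc m) powr (-s) * of_real (x * real (Suc m)) powr w
                     = of_real x powr w * of_nat (Suc m) powr (- (s - w))" for m w
  proof -
    have "of_real (x * real (Suc m)) powr w = of_real x powr w * (of_nat (Suc m) powr w :: complex)"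
      using x powr_times_real[of "of_real x" "of_nat (Suc m)" w] by simp
    moreover have "of_nat (Suc m) powr (- (s - w)) = of_nat (Suc m) powr (-s) * (of_nat (Suc m) powr w :: complex)"
      using powr_add[of "of_nat (Suc m) :: complex" "-s" w] by (simp add: algebra_simps del: of_nat_Suc)
    ultimately show ?thesis by (simp only: mult_ac)
  qed
  have zeta: "(\<lambda>m. c * (of_real x powr w * of_nat (Suc m) powr (- (s - w)))) sums
                 (c * (of_real x powr w * riemann_zeta (s - w)))" if "Re (s - w) > 1" for c w
    using that by (intro sums_mult sums_riemann_zeta)
  have B: "(\<lambda>m. em_lead a t * (of_real x powr (of_nat (Suc a) - t) * of_nat (Suc m) powr (- (s - (of_nat (Suc a) - t))))
           + (\<Sum>k<K-a. ((-t gchoose k) * zeta_neg (a + k)) * (of_real x powr (-t - of_nat k) * of_nat (Suc m) powr (- (s - (-t - of_nat k))))))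
         sums (em_lead a t * (of_real x powr (of_nat (Suc a) - t) * riemann_zeta (s - (of_nat (Suc a) - t)))
           + (\<Sum>k<K-a. ((-t gchoose k) * zeta_neg (a + k)) * (of_real x powr (-t - of_nat k) * riemann_zeta (s - (-t - of_nat k)))))"
    using t by (intro sums_add sums_sum zeta) auto
  \<comment> \<open>Convergence of the remainder series and its value are obtained together, by
    subtracting the explicit series \<open>B\<close> from \<open>A\<close>.\<close>
  have "(\<lambda>m. of_nat (Suc m) powr (-s) * em_rem_pow K a t (x * real (Suc m))) sums
     (MT_series x (- of_nat a) s t - (em_lead a t * (of_real x powr (of_nat (Suc a) - t) * riemann_zeta (s - (of_nat (Suc a) - t)))
           + (\<Sum>k<K-a. ((-t gchoose k) * zeta_neg (a + k)) * (of_real x powr (-t - of_nat k) * riemann_zeta (s - (-t - of_nat k))))))"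
  proof -
    have "of_nat (Suc m) powr (-s) * S (x * real (Suc m)) -
        (em_lead a t * (of_real x powr (of_nat (Suc a) - t) * of_nat (Suc m) powr (- (s - (of_nat (Suc a) - t))))
           + (\<Sum>k<K-a. ((-t gchoose k) * zeta_neg (a + k)) * (of_real x powr (-t - of_nat k) * of_nat (Suc m) powr (- (s - (-t - of_nat k))))))
        = of_nat (Suc m) powr (-s) * em_rem_pow K a t (x * real (Suc m))" for m
      unfolding S_def powr_split [symmetric] distrib_left sum_distrib_left
      by (simp add: mult_ac)
    with sums_diff[OF A B] show ?thesis by simp
  qed
  hence "MT_rem K a x s t = (MT_series x (- of_nat a) s t - (em_lead a t * (of_real x powr (of_nat (Suc a) - t) * riemann_zeta (s - (of_nat (Suc a) - t)))
           + (\<Sum>k<K-a. ((-t gchoose k) * zeta_neg (a + k)) * (of_real x powr (-t - of_nat k) * riemann_zeta (s - (-t - of_nat k))))))"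
    unfolding MT_rem_def by (rule sums_unique [symmetric])
  moreover have "s - (of_nat (Suc a) - t) = s + t - of_nat (Suc a)" "s - (-t - of_nat k) = s + t + of_nat k" for k
    by simp_all
  ultimately show ?thesis unfolding MT_em_def by (simp add: mult_ac del: of_nat_Suc)
qed

text \<open>The summand is at most of size m^(1 + a - Re t - K - Re s). The second entry of the
  maximum makes this exponent less than -2, and increasing \<open>K\<close> moves the half plane
  arbitrarily far to the left.\<close>

lemma holomorphic_on_MT_rem:
  assumes x: "x > 0"
  shows "(\<lambda>t. MT_rem K a x s t) holomorphic_on
           {t. Re t > max (1 + real a - real K) (3 + real a - real K - Re s)}" (is "_ holomorphic_on ?V")
proof -
  obtain b where b: "continuous_on UNIV b" "\<And>t y. Re t \<ge> 1 + real a - real K \<Longrightarrow> y \<ge> x \<Longrightarrow>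
           norm (em_rem_pow K a t y) \<le> b t * y powr (1 + real a - Re t - real K)"
    using norm_em_rem_pow_le[OF x, of a K] by blast
  show ?thesis unfolding MT_rem_def
  proof (rule holomorphic_on_suminf_majorised)
    show "open ?V" by (rule open_halfspace_Re_gt)
    show "(\<lambda>t. of_nat (Suc m) powr (-s) * em_rem_pow K a t (x * real (Suc m))) holomorphic_on ?V" for m
    proof -
      have "(\<lambda>t. em_rem_pow K a t (x * real (Suc m))) holomorphic_on ?V"
        by (rule holomorphic_on_subset[OF holomorphic_on_em_rem_pow]) (use x in auto)
      thus ?thesis by (intro holomorphic_intros)
    qed
    show "continuous_on ?V (\<lambda>t. b t * x powr (1 + real a - Re t - real K))"
      using x by (intro continuous_intros continuous_on_subset[OF b(1)]) auto
    have "summable (\<lambda>n. real n powr (-2))" by (subst summable_real_powr_iff) auto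
    thus "summable (\<lambda>n. real (Suc n) powr (-2))" by (subst summable_Suc_iff)
    show "norm (of_nat (Suc m) powr (-s) * em_rem_pow K a t (x * real (Suc m)))
            \<le> b t * x powr (1 + real a - Re t - real K) * real (Suc m) powr (-2)" if t: "t \<in> ?V" for m t
    proof -
      define e where "e = 1 + real a - Re t - real K"
      have e: "- Re s + e \<le> -2" using t by (simp add: e_def)
      have bt: "norm (em_rem_pow K a t y) \<le> b t * y powr e" if "y \<ge> x" for y
        using b(2)[of t y] t that by (simp add: e_def)
      \<comment> \<open>No sign of \<open>b\<close> is known; nonnegativity is read off from the
        bound itself at \<open>y = x\<close>.\<close>
      have "0 \<le> b t * x powr e" using order.trans[OF norm_ge_zero bt[of x]] by simp
      have "norm (of_nat (Suc m) powr (-s) :: complex) = real (Suc m) powr (- Re s)"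
        by (subst norm_powr_real_powr) auto
      hence "norm (of_nat (Suc m) powr (-s) * em_rem_pow K a t (x * real (Suc m)))
          = real (Suc m) powr (- Re s) * norm (em_rem_pow K a t (x * real (Suc m)))"
        by (simp only: norm_mult)
      also have "\<dots> \<le> real (Suc m) powr (- Re s) * (b t * (x * real (Suc m)) powr e)"
        using x by (intro mult_left_mono bt) (auto simp: algebra_simps)
      also have "\<dots> = b t * x powr e * (real (Suc m) powr (- Re s) * real (Suc m) powr e)"
        using x by (simp add: powr_mult mult_ac del: of_nat_Suc)
      also have "\<dots> \<le> b t * x powr e * real (Suc m) powr (-2)"
        unfolding powr_add [symmetric] using e \<open>0 \<le> b t * x powr e\<close>
        by (intro mult_left_mono powr_mono) auto
      finally show ?thesis by (simp add: e_def)
    qed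
  qed auto
qed

lemma MT_rem_neg_of_nat:
  assumes "x > 0" "N + a < K"
  shows "MT_rem K a x s (- of_nat N) = 0"
  using assms by (simp add: MT_rem_def em_rem_pow_neg_of_nat del: of_nat_Suc)

section \<open>Continuation in one variable\<close>

definition MT_sing_slice :: "complex \<Rightarrow> complex \<Rightarrow> complex set" where
  "MT_sing_slice r s = {t. (r, s, t) \<in> MT_singular_set}"

lemma MT_sing_slice_subset:
  "MT_sing_slice r s \<subseteq> (+) (-r) ` \<int> \<union> (+) (-s) ` \<int> \<union> {2 - r - s}"
proof
  fix t assume "t \<in> MT_sing_slice r s"
  hence "r + t \<in> \<int> \<or> s + t \<in> \<int> \<or> r + s + t = 2"
    by (auto simp: MT_sing_slice_def MT_singular_set_def)
  hence "r + t \<in> \<int> \<or> s + t \<in> \<int> \<or> t = 2 - r - s"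
    by (auto simp: eq_diff_eq add_ac)
  moreover have "t = -r + (r + t)" "t = -s + (s + t)" by simp_all
  ultimately show "t \<in> (+) (-r) ` \<int> \<union> (+) (-s) ` \<int> \<union> {2 - r - s}" by blast
qed

text \<open>Every set of integers is closed, and so is each translate. The claim concerns all
  subsets so that it also covers the slice with one point deleted, which is needed for punctured
  neighbourhoods.\<close>

lemma closed_subset_MT_sing_slice:
  assumes "B \<subseteq> MT_sing_slice r s"
  shows "closed B"
proof -
  have closed: "closed C" if C: "C \<subseteq> (+) c ` \<int>" for C and c :: complex
  proof -
    have "closed ((+) (-c) ` C)" using C by (intro closed_subset_Ints) auto
    hence "closed ((+) c ` ((+) (-c) ` C))" by (rule closed_translation)
    thus ?thesis by (simp add: image_image)
  qed
  have "closed (B \<inter> (+) (-r) ` \<int>)" "closed (B \<inter> (+) (-s) ` \<int>)"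
    by (rule closed, blast)+
  moreover have "closed (B \<inter> {2 - r - s})" by (cases "2 - r - s \<in> B") auto
  moreover have "B = B \<inter> (+) (-r) ` \<int> \<union> B \<inter> (+) (-s) ` \<int> \<union> B \<inter> {2 - r - s}"
    using assms MT_sing_slice_subset[of r s] by blast
  ultimately show ?thesis by (metis closed_Un)
qed

lemma countable_MT_sing_slice: "countable (MT_sing_slice r s)"
  by (rule countable_subset[OF MT_sing_slice_subset])
     (intro countable_Un countable_image countable_int countable_finite finite.intros)

lemma eventually_not_in_MT_sing_slice: "eventually (\<lambda>t. t \<notin> MT_sing_slice r s) (at t0)"
proof -
  have "open (- (MT_sing_slice r s - {t0}))"
    by (intro open_Compl closed_subset_MT_sing_slice) auto
  thus ?thesis unfolding eventually_at_topological by blast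
qed

lemma holomorphic3_on_slice:
  assumes "holomorphic3_on (\<lambda>(r, s, t). f r s t) S"
  shows "(\<lambda>t. f r s t) holomorphic_on {t. (r, s, t) \<in> S}" (is "_ holomorphic_on ?T")
proof (rule holomorphic_onI)
  fix t assume t: "t \<in> ?T"
  then obtain a b c where "((\<lambda>(r, s, t). f r s t) has_derivative (\<lambda>(u, v, w). a * u + b * v + c * w))
                              (at (r, s, t) within S)"
    using assms unfolding holomorphic3_on_def by blast
  hence *: "((\<lambda>(r, s, t). f r s t) has_derivative (\<lambda>(u, v, w). a * u + b * v + c * w))
                              (at (r, s, t) within (\<lambda>t. (r, s, t)) ` ?T)"
    by (rule has_derivative_subset) auto
  have "((\<lambda>t. (r, s, t)) has_derivative (\<lambda>h. (0, 0, h))) (at t within ?T)"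
    by (intro has_derivative_Pair has_derivative_const has_derivative_ident)
  from has_derivative_in_compose[OF this *] have "((\<lambda>t. (\<lambda>(r, s, t). f r s t) (r, s, t)) has_derivative
        (\<lambda>h. (\<lambda>(u, v, w). a * u + b * v + c * w) (0, 0, h))) (at t within ?T)" .
  hence "((\<lambda>t. f r s t) has_field_derivative c) (at t within ?T)"
    by (simp add: has_field_derivative_def)
  thus "(\<lambda>t. f r s t) field_differentiable at t within ?T"
    unfolding field_differentiable_def by blast
qed

lemma holomorphic_on_riemann_zeta_compose:
  assumes "f holomorphic_on A" "\<And>z. z \<in> A \<Longrightarrow> f z \<noteq> 1"
  shows "(\<lambda>z. riemann_zeta (f z)) holomorphic_on A"
proof -
  have "f ` A \<subseteq> - {1}" using assms(2) by auto
  from holomorphic_on_compose_gen[OF assms(1) holomorphic_on_riemann_zeta this]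
  show ?thesis by (simp add: o_def)
qed

lemma holomorphic_on_em_lead:
  assumes "\<And>j. j \<in> {1..Suc a} \<Longrightarrow> of_nat j \<notin> A"
  shows "em_lead a holomorphic_on A"
proof -
  have "(\<Prod>j=1..Suc a. t - of_nat j) \<noteq> 0" if "t \<in> A" for t
    using assms that by (auto simp: prod_zero_iff simp del: of_nat_Suc)
  thus ?thesis unfolding em_lead_def[abs_def] by (intro holomorphic_intros) auto
qed

text \<open>All poles lie on the singular hyperplanes: those of \<open>em_lead\<close> on
  \<open>r + t = 1 - l\<close>, that of the leading zeta factor on \<open>r + s + t = 2\<close>, and
  those of the other zeta factors on \<open>s + t = 1 - k\<close>.\<close>

lemma holomorphic_on_MT_em:
  assumes x: "x > 0"
  shows "MT_em K a x s holomorphic_on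
     {t. Re t > max (1 + real a - real K) (3 + real a - real K - Re s)} - MT_sing_slice (- of_nat a) s"
    (is "_ holomorphic_on ?V - ?A")
proof -
  have nz: "of_real x \<noteq> (0::complex)" using x by simp
  have A1: "of_nat j \<in> ?A" if "j \<in> {1..Suc a}" for j
  proof -
    have "- of_nat a + of_nat j = (1 - of_nat (Suc a - j) :: complex)"
      using that by (simp add: of_nat_diff)
    thus ?thesis unfolding MT_sing_slice_def MT_singular_set_def by blast
  qed
  have A2: "t \<in> ?A" if "s + t - of_nat (Suc a) = 1" for t
    using that by (auto simp: MT_sing_slice_def MT_singular_set_def algebra_simps)
  have A3: "t \<in> ?A" if "s + t + of_nat k = 1" for t k
    using that by (auto simp: MT_sing_slice_def MT_singular_set_def algebra_simps)
  have "em_lead a holomorphic_on ?V - ?A"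
    using A1 by (intro holomorphic_on_em_lead) blast
  moreover have "(\<lambda>t. MT_rem K a x s t) holomorphic_on ?V - ?A"
    by (rule holomorphic_on_subset[OF holomorphic_on_MT_rem[OF x]]) auto
  moreover have "(\<lambda>t. riemann_zeta (s + t - of_nat (Suc a))) holomorphic_on ?V - ?A"
    using A2 by (intro holomorphic_on_riemann_zeta_compose holomorphic_intros) blast
  moreover have "(\<lambda>t. riemann_zeta (s + t + of_nat k)) holomorphic_on ?V - ?A" for k
    using A3 by (intro holomorphic_on_riemann_zeta_compose holomorphic_intros) blast
  ultimately show ?thesis
    unfolding MT_em_def[abs_def] using nz by (intro holomorphic_intros)
qed

lemma is_MT_zeta_eq_MT_em:
  assumes x: "x > 0" and \<Theta>: "is_MT_zeta x \<Theta>" and K: "a \<le> K"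
    and t: "Re t > max (1 + real a - real K) (3 + real a - real K - Re s)"
           "t \<notin> MT_sing_slice (- of_nat a) s"
  shows "\<Theta> (- of_nat a) s t = MT_em K a x s t"
proof (rule half_plane_identity[where f = "\<lambda>t. \<Theta> (- of_nat a) s t" and g = "MT_em K a x s"
         and A = "MT_sing_slice (- of_nat a) s" and d = "real a + 4 + \<bar>Re s\<bar>"])
  have "(\<lambda>t. \<Theta> (- of_nat a) s t) holomorphic_on {t. (- of_nat a, s, t) \<in> - MT_singular_set}"
    using \<Theta> by (intro holomorphic3_on_slice) (simp add: is_MT_zeta_def)
  thus "(\<lambda>t. \<Theta> (- of_nat a) s t) holomorphic_on
     {t. Re t > max (1 + real a - real K) (3 + real a - real K - Re s)} - MT_sing_slice (- of_nat a) s"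
    by (rule holomorphic_on_subset) (auto simp: MT_sing_slice_def)
  show "MT_em K a x s holomorphic_on
     {t. Re t > max (1 + real a - real K) (3 + real a - real K - Re s)} - MT_sing_slice (- of_nat a) s"
    by (rule holomorphic_on_MT_em[OF x])
  show "closed (MT_sing_slice (- of_nat a) s)" by (rule closed_subset_MT_sing_slice[OF order.refl])
  show "countable (MT_sing_slice (- of_nat a) s)" by (rule countable_MT_sing_slice)
  show "u \<notin> MT_sing_slice (- of_nat a) s \<and> \<Theta> (- of_nat a) s u = MT_em K a x s u"
    if u: "Re u > real a + 4 + \<bar>Re s\<bar>" for u
  proof
    show "u \<notin> MT_sing_slice (- of_nat a) s"
      using u by (auto simp: MT_sing_slice_def MT_singular_set_def complex_eq_iff)
    have "(- of_nat a, s, u) \<in> MT_convergence_region"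
      using u by (auto simp: MT_convergence_region_def)
    hence "\<Theta> (- of_nat a) s u = MT_series x (- of_nat a) s u"
      using \<Theta> unfolding is_MT_zeta_def by blast
    also have "\<dots> = MT_em K a x s u"
      using u by (intro MT_series_eq_MT_em x K) auto
    finally show "\<Theta> (- of_nat a) s u = MT_em K a x s u" .
  qed
qed (use t in auto)

section \<open>First-order local expansions, with and without a pole of zeta\<close>

lemma bigo_diff_of_DERIV:
  fixes h :: "complex \<Rightarrow> complex"
  assumes "(h has_field_derivative D) (at z)"
  shows "(\<lambda>t. h t - h z) \<in> O[at z](\<lambda>t. t - z)"
proof (rule bigoI_tendsto)
  show "((\<lambda>t. (h t - h z) / (t - z)) \<longlongrightarrow> D) (at z)"
    using assms by (simp add: has_field_derivative_iff)
  show "eventually (\<lambda>t. t - z \<noteq> 0) (at z)"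
    by (auto simp: eventually_at_filter)
qed

lemma bigo_diff_of_holomorphic:
  fixes h :: "complex \<Rightarrow> complex"
  assumes "h holomorphic_on S" "open S" "z \<in> S"
  shows "(\<lambda>t. h t - h z) \<in> O[at z](\<lambda>t. t - z)"
proof -
  obtain D where "(h has_field_derivative D) (at z)"
    using assms holomorphic_on_open by blast
  thus ?thesis by (rule bigo_diff_of_DERIV)
qed

text \<open>Multiplying zeta(1+u) = 1/u + gamma + O(u) by g(z+u) = g(z) + D u + O(u^2) shows that
  the singular and constant parts depend on \<open>g z\<close> and \<open>D\<close> alone. In the
  proof, \<open>G\<close> is the difference quotient of \<open>g\<close> completed at
  \<open>z\<close>, and \<open>H z\<close> is exactly the stated constant.\<close>

lemma bigo_zeta_pole:
  fixes g :: "complex \<Rightarrow> complex"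
  assumes g: "g holomorphic_on S" "open S" "z \<in> S" and D: "(g has_field_derivative D) (at z)"
  shows "(\<lambda>t. g t * riemann_zeta (1 + (t - z)) - (g z / (t - z) + (D + euler_mascheroni * g z)))
           \<in> O[at z](\<lambda>t. t - z)"
proof -
  obtain h where h: "h holomorphic_on {t. Re t > 0}" "h 1 = euler_mascheroni"
    "\<And>t. Re t > 0 \<Longrightarrow> t \<noteq> 1 \<Longrightarrow> riemann_zeta t = 1 / (t - 1) + h t"
    using riemann_zeta_laurent_1 by blast
  define U where "U = S \<inter> {t. Re t > Re z - 1}"
  define G where "G = (\<lambda>t. if t = z then deriv g z else (g t - g z) / (t - z))"
  define H where "H = (\<lambda>t. G t + g t * h (1 + (t - z)))"
  have U: "open U" "z \<in> U" using g by (auto simp: U_def intro!: open_Int open_halfspace_Re_gt)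
  have gU: "g holomorphic_on U" by (rule holomorphic_on_subset[OF g(1)]) (auto simp: U_def)
  have "G holomorphic_on U"
    unfolding G_def by (rule pole_lemma_open[OF gU U(1)])
  moreover have "(h \<circ> (\<lambda>t. 1 + (t - z))) holomorphic_on U"
    by (rule holomorphic_on_compose_gen[OF _ h(1)]) (auto simp: U_def intro!: holomorphic_intros)
  ultimately have "H holomorphic_on U"
    unfolding H_def using gU by (auto simp: o_def intro!: holomorphic_intros)
  from bigo_diff_of_holomorphic[OF this U]
  have "(\<lambda>t. H t - H z) \<in> O[at z](\<lambda>t. t - z)" .
  moreover have "eventually (\<lambda>t. H t - H z = 
      g t * riemann_zeta (1 + (t - z)) - (g z / (t - z) + (D + euler_mascheroni * g z))) (at z)"
  proof -
    have "eventually (\<lambda>t. t \<in> U) (at z)" using U by (rule eventually_at_in_open')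
    moreover have "eventually (\<lambda>t. t \<noteq> z) (at z)" by (auto simp: eventually_at_filter)
    ultimately show ?thesis
    proof eventually_elim
      case (elim t)
      have "riemann_zeta (1 + (t - z)) = 1 / (t - z) + h (1 + (t - z))"
        using h(3)[of "1 + (t - z)"] elim by (simp add: U_def)
      moreover have "deriv g z = D" using D by (rule DERIV_imp_deriv)
      ultimately show ?case using elim h(2)
        by (simp add: H_def G_def diff_divide_distrib algebra_simps)
    qed
  qed
  ultimately show ?thesis by (subst (asm) landau_o.big.in_cong) auto
qed

lemma bigo_diff_cong:
  assumes "(\<lambda>t. f t - g t) \<in> O[F](h)" "eventually (\<lambda>t. f' t = f t) F" "\<And>t. g' t = g t"
  shows "(\<lambda>t. f' t - g' t) \<in> O[F](h)"
proof -
  have "eventually (\<lambda>t. f' t - g' t = f t - g t) F"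
    using assms(2) by eventually_elim (simp add: assms(3))
  thus ?thesis using assms(1) by (subst landau_o.big.in_cong) auto
qed

text \<open>\<open>L\<close> and \<open>V k\<close> are arbitrary local expansions, which the
  individual cases supply. The bounds on \<open>K\<close> put \<open>-N\<close> inside the half
  plane of \<open>MT_em\<close> and make \<open>MT_rem\<close> vanish there.\<close>

lemma theta_expansion:
  assumes x: "x > 0" and \<Theta>: "is_MT_zeta x \<Theta>"
    and K: "a + N + 1 < K" "real K > 3 + real a + real N - Re s"
    and lead: "(\<lambda>t. em_lead a t * of_real x powr (of_nat (Suc a) - t) * riemann_zeta (s + t - of_nat (Suc a)) - L t)
                 \<in> O[at (- of_nat N)](\<lambda>t. t - (- of_nat N))"
    and terms: "\<And>k. k < K - a \<Longrightarrow>
        (\<lambda>t. (-t gchoose k) * zeta_neg (a + k) * of_real x powr (-t - of_nat k) * riemann_zeta (s + t + of_nat k) - V k t)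
                 \<in> O[at (- of_nat N)](\<lambda>t. t - (- of_nat N))"
  shows "(\<lambda>t. \<Theta> (- of_nat a) s t - (L t + (\<Sum>k<K-a. V k t))) \<in> O[at (- of_nat N)](\<lambda>t. t - (- of_nat N))"
proof -
  let ?t0 = "- of_nat N :: complex"
  let ?V = "{t. Re t > max (1 + real a - real K) (3 + real a - real K - Re s)}"
  have V: "open ?V" by (rule open_halfspace_Re_gt)
  have t0V: "?t0 \<in> ?V" using K by auto
  have "(\<lambda>t. MT_rem K a x s t - MT_rem K a x s ?t0) \<in> O[at ?t0](\<lambda>t. t - ?t0)"
    by (rule bigo_diff_of_holomorphic[OF holomorphic_on_MT_rem[OF x] V t0V])
  moreover have "MT_rem K a x s ?t0 = 0" using x K by (intro MT_rem_neg_of_nat) auto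
  ultimately have rem: "(\<lambda>t. MT_rem K a x s t) \<in> O[at ?t0](\<lambda>t. t - ?t0)" by simp
  have terms': "(\<lambda>t. \<Sum>k<K-a. (-t gchoose k) * zeta_neg (a + k) * of_real x powr (-t - of_nat k) * riemann_zeta (s + t + of_nat k) - V k t)
                 \<in> O[at ?t0](\<lambda>t. t - ?t0)"
    by (rule big_sum_in_bigo) (use terms in auto)
  have "(\<lambda>t. MT_em K a x s t - (L t + (\<Sum>k<K-a. V k t))) \<in> O[at ?t0](\<lambda>t. t - ?t0)"
    using sum_in_bigo(1)[OF sum_in_bigo(1)[OF lead terms'] rem]
    by (simp add: MT_em_def sum_subtractf algebra_simps)
  moreover have "eventually (\<lambda>t. \<Theta> (- of_nat a) s t = MT_em K a x s t) (at ?t0)"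
    using eventually_not_in_MT_sing_slice[of "- of_nat a" s ?t0] eventually_at_in_open'[OF V t0V]
  proof eventually_elim
    case (elim t)
    thus ?case using K by (intro is_MT_zeta_eq_MT_em[OF x \<Theta>]) auto
  qed
  ultimately show ?thesis by (rule bigo_diff_cong) auto
qed

section \<open>Local expansions of the terms\<close>

lemma gbinomial_has_derivative_Suc:
  assumes "((\<lambda>z. z gchoose k) has_field_derivative D) (at z)"
  shows "((\<lambda>z::complex. z gchoose Suc k) has_field_derivative
            (D * (z - of_nat k) + (z gchoose k)) / of_nat (Suc k)) (at z)"
proof -
  have "((\<lambda>z. (z gchoose k) * (z - of_nat k) / of_nat (Suc k)) has_field_derivative
            (D * (z - of_nat k) + (z gchoose k)) / of_nat (Suc k)) (at z)"
    using assms by (auto intro!: derivative_eq_intros simp del: of_nat_Suc)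
  also have "(\<lambda>z. (z gchoose k) * (z - of_nat k) / of_nat (Suc k)) = (\<lambda>z::complex. z gchoose Suc k)"
  proof
    fix z :: complex
    have "of_nat (Suc k) * (z gchoose Suc k) = (z gchoose k) * (z - of_nat k)"
      using gbinomial_mult_1[of z k] by (simp add: algebra_simps)
    thus "(z gchoose k) * (z - of_nat k) / of_nat (Suc k) = (z gchoose Suc k)"
      by (simp add: field_simps del: of_nat_Suc)
  qed
  finally show ?thesis .
qed

text \<open>The logarithmic derivative of z(z-1)...(z-k+1) at \<open>N\<close> is the sum of 1/(N-i)
  over \<open>i < k\<close>, a difference of harmonic numbers.\<close>

lemma gbinomial_has_derivative_le:
  assumes "k \<le> N"
  shows "((\<lambda>z::complex. z gchoose k) has_field_derivative of_nat (N choose k) * (harm N - harm (N - k))) (at (of_nat N))"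
  using assms
proof (induction k)
  case (Suc k)
  define j where "j = N - Suc k"
  have N: "N = Suc (k + j)" using Suc.prems by (simp add: j_def)
  have "of_nat (Suc k) * of_nat (N choose Suc k) = (of_nat (N choose k) * of_nat (Suc j) :: complex)"
  proof -
    have "Suc k * (N choose Suc k) = (N choose k) * Suc j"
      using binomial_absorb_comp[of N k] binomial_absorption[of k N] unfolding N by (simp add: algebra_simps)
    thus ?thesis by (metis of_nat_mult)
  qed
  hence b: "of_nat (N choose Suc k) = (of_nat (N choose k) * of_nat (Suc j) / of_nat (Suc k) :: complex)"
    by (simp add: field_simps del: of_nat_Suc)
  have h: "harm (N - k) = harm j + inverse (of_nat (Suc j) :: complex)"
    by (simp add: N harm_Suc)
  have "N - Suc k = j" "of_nat N - of_nat k = (of_nat (Suc j) :: complex)" by (simp_all add: N)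
  moreover have "(of_nat N gchoose k) = (of_nat (N choose k) :: complex)"
    by (simp add: binomial_gbinomial)
  moreover have "((\<lambda>z::complex. z gchoose Suc k) has_field_derivative
      (of_nat (N choose k) * (harm N - harm (N - k)) * (of_nat N - of_nat k) + (of_nat N gchoose k)) / of_nat (Suc k)) (at (of_nat N))"
    using Suc by (intro gbinomial_has_derivative_Suc) auto
  ultimately show ?case
    unfolding b h by (elim DERIV_cong) (simp add: field_simps del: of_nat_Suc)
qed auto

text \<open>Now \<open>z - N\<close> is one of the factors, so the derivative is the product of the
  others: N! from those before it, (-1)(-2)...(-d) from those after it.\<close>

lemma gbinomial_has_derivative_gt:
  "((\<lambda>z::complex. z gchoose Suc (N + d)) has_field_derivative
      (-1) ^ d * fact N * fact d / fact (Suc (N + d))) (at (of_nat N))"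
proof (induction d)
  case 0
  have g: "(of_nat N gchoose N) = (1::complex)"
    by (simp add: binomial_gbinomial [symmetric])
  have "((\<lambda>z::complex. z gchoose Suc N) has_field_derivative 1 / of_nat (Suc N)) (at (of_nat N))"
    using gbinomial_has_derivative_Suc[OF gbinomial_has_derivative_le[OF order.refl], of N] unfolding g
    by (simp del: of_nat_Suc)
  thus ?case by (simp del: of_nat_Suc)
next
  case (Suc d)
  have g: "(of_nat N gchoose Suc (N + d)) = (0::complex)"
    by (simp add: binomial_gbinomial [symmetric] del: of_nat_Suc)
  have e: "of_nat N - of_nat (Suc (N + d)) = - (of_nat (Suc d) :: complex)" by simp
  show ?case
    using gbinomial_has_derivative_Suc[OF Suc.IH] unfolding g e
    by (simp add: mult_ac del: of_nat_Suc)
qed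

lemma em_lead_Suc_mult: "em_lead (Suc a) t = em_lead a t * (of_nat (Suc a) / (t - of_nat (Suc (Suc a))))"
  unfolding em_lead_def by (subst prod.nat_ivl_Suc') (auto simp: divide_simps mult_ac)

lemma em_lead_neg_of_nat:
  "em_lead a (- of_nat N) = (-1) ^ Suc a * fact a * fact N / fact (Suc (a + N))"
proof (induction a)
  case 0
  have "- of_nat N - 1 = - (of_nat (Suc N) :: complex)" by simp
  moreover have "em_lead 0 (- of_nat N) = 1 / (- of_nat N - 1)" by (simp add: em_lead_def)
  ultimately have "em_lead 0 (- of_nat N) = - (1 / of_nat (Suc N))" by (simp del: of_nat_Suc)
  thus ?case by (simp add: field_simps del: of_nat_Suc)
next
  case (Suc a)
  have "- of_nat N - of_nat (Suc (Suc a)) = - (of_nat (Suc (Suc (a + N))) :: complex)" by simp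
  thus ?case unfolding em_lead_Suc_mult Suc
    by (simp add: mult_ac del: of_nat_Suc)
qed

lemma divide_linear_has_derivative:
  "z \<noteq> d \<Longrightarrow> ((\<lambda>t. c / (t - d)) has_field_derivative - c / (z - d)\<^sup>2) (at (z :: complex))"
  by (auto intro!: derivative_eq_intros simp: power2_eq_square)

lemma powr_minus_has_derivative:
  assumes "x > 0"
  shows "((\<lambda>t. of_real x powr (c - t :: complex)) has_field_derivative (- of_real (ln x) * of_real x powr (c - z))) (at z)"
proof -
  have "((\<lambda>w. of_real x powr w) has_field_derivative Ln (of_real x) * of_real x powr (c - z)) (at (c - z))"
    using assms by (intro has_field_derivative_powr_right) auto
  moreover have "((\<lambda>t. c - t) has_field_derivative - 1) (at z)"
    by (auto intro!: derivative_eq_intros)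
  ultimately show ?thesis
    using DERIV_chain2 assms by (fastforce simp: Ln_of_real)
qed

text \<open>At \<open>-N\<close> the logarithmic derivative, minus the sum of 1/(t-j) for j = 1,
  ..., a+1, becomes the sum of 1/(N+j).\<close>

lemma em_lead_has_derivative:
  "(em_lead a has_field_derivative em_lead a (- of_nat N) * (harm (Suc (a + N)) - harm N)) (at (- of_nat N))"
proof (induction a)
  case 0
  have e: "- of_nat N - 1 = - (of_nat (Suc N) :: complex)" by simp
  have "- of_nat N \<noteq> (1 :: complex)" by (metis e diff_self neg_equal_0_iff_equal of_nat_neq_0)
  from divide_linear_has_derivative[OF this, of 1]
  have "((\<lambda>t::complex. 1 / (t - 1)) has_field_derivative - 1 / (- of_nat N - 1)\<^sup>2) (at (- of_nat N))" .
  moreover have "em_lead 0 = (\<lambda>t. 1 / (t - 1))" by (auto simp: em_lead_def)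
  ultimately show ?case
    by (simp add: e harm_Suc power2_eq_square field_simps del: of_nat_Suc)
next
  case (Suc a)
  define M :: complex where "M = of_nat (Suc (Suc (a + N)))"
  have e: "- of_nat N - of_nat (Suc (Suc a)) = - M" by (simp add: M_def)
  have "M \<noteq> 0" unfolding M_def by (rule of_nat_neq_0)
  hence "- of_nat N \<noteq> (of_nat (Suc (Suc a)) :: complex)" using e by auto
  from DERIV_mult[OF Suc.IH divide_linear_has_derivative[OF this, of "of_nat (Suc a)"]]
  have "((\<lambda>t. em_lead a t * (of_nat (Suc a) / (t - of_nat (Suc (Suc a))))) has_field_derivative
      em_lead a (- of_nat N) * (harm (Suc (a + N)) - harm N) * (of_nat (Suc a) / (- M))
      + - of_nat (Suc a) / (- M)\<^sup>2 * em_lead a (- of_nat N)) (at (- of_nat N))"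
    unfolding e .
  moreover have "em_lead (Suc a) = (\<lambda>t. em_lead a t * (of_nat (Suc a) / (t - of_nat (Suc (Suc a)))))"
    using em_lead_Suc_mult by blast
  moreover have "harm (Suc (Suc a + N)) = harm (Suc (a + N)) + inverse M"
    by (simp add: harm_Suc M_def)
  moreover have "em_lead a (- of_nat N) * (harm (Suc (a + N)) - harm N) * (of_nat (Suc a) / (- M))
      + - of_nat (Suc a) / (- M)\<^sup>2 * em_lead a (- of_nat N)
     = em_lead a (- of_nat N) * (of_nat (Suc a) / (- M)) * (harm (Suc (a + N)) + inverse M - harm N)"
    using \<open>M \<noteq> 0\<close> by (simp add: divide_simps power2_eq_square) (simp add: algebra_simps)
  ultimately show ?case by (simp only: e)
qed

lemma powr_at_neg_of_nat:
  assumes "x > 0"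
  shows "of_real x powr (- (- of_nat N) - of_nat k) = (of_real x powi (int N - int k) :: complex)"
  using assms complex_powr_of_int[of "of_real x" "int N - int k"] by simp

lemma MT_term_regular:
  assumes x: "x > 0" and s: "s + of_nat k \<noteq> of_nat (Suc N)"
  shows "(\<lambda>t. (-t gchoose k) * zeta_neg (a + k) * of_real x powr (-t - of_nat k) * riemann_zeta (s + t + of_nat k)
            - of_nat (N choose k) * zeta_neg (a + k) * of_real x powi (int N - int k) * riemann_zeta (s - of_nat N + of_nat k))
         \<in> O[at (- of_nat N)](\<lambda>t. t - (- of_nat N))"
proof -
  let ?h = "\<lambda>t. (-t gchoose k) * zeta_neg (a + k) * of_real x powr (-t - of_nat k) * riemann_zeta (s + t + of_nat k)"
  let ?S = "- {1 - s - of_nat k}"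
  have "(\<lambda>t. riemann_zeta (s + t + of_nat k)) holomorphic_on ?S"
    by (intro holomorphic_on_riemann_zeta_compose holomorphic_intros) (auto simp: algebra_simps)
  hence "?h holomorphic_on ?S" using x by (intro holomorphic_intros) auto
  moreover have "- of_nat N \<in> ?S" using s by (auto simp: algebra_simps)
  ultimately have "(\<lambda>t. ?h t - ?h (- of_nat N)) \<in> O[at (- of_nat N)](\<lambda>t. t - (- of_nat N))"
    by (intro bigo_diff_of_holomorphic[of _ ?S]) auto
  also have "?h (- of_nat N) = of_nat (N choose k) * zeta_neg (a + k) * of_real x powi (int N - int k) * riemann_zeta (s - of_nat N + of_nat k)"
    unfolding powr_at_neg_of_nat[OF x] by (simp add: binomial_gbinomial)
  finally show ?thesis .
qed

text \<open>The constant part combines gamma from zeta, \<open>- ln x\<close> from the power and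
  \<open>- D\<close> from the binomial, the last sign coming from the inner function
  \<open>-t\<close>. For \<open>k > N\<close> the coefficient \<open>N choose k\<close> is zero and
  only the \<open>D\<close> term remains.\<close>

lemma MT_term_pole:
  assumes x: "x > 0" and s: "s + of_nat k = of_nat (Suc N)"
    and D: "((\<lambda>z. z gchoose k) has_field_derivative D) (at (of_nat N))"
  shows "(\<lambda>t. (-t gchoose k) * zeta_neg (a + k) * of_real x powr (-t - of_nat k) * riemann_zeta (s + t + of_nat k)
            - zeta_neg (a + k) * of_real x powi (int N - int k) *
                (of_nat (N choose k) / (t - (- of_nat N))
                 + of_nat (N choose k) * (euler_mascheroni - of_real (ln x)) - D))
         \<in> O[at (- of_nat N)](\<lambda>t. t - (- of_nat N))"
proof -
  let ?t0 = "- of_nat N :: complex"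
  let ?g = "\<lambda>t. (-t gchoose k) * zeta_neg (a + k) * of_real x powr (-t - of_nat k)"
  let ?c = "zeta_neg (a + k) * of_real x powi (int N - int k)"
  have g0: "?g ?t0 = of_nat (N choose k) * ?c"
    unfolding powr_at_neg_of_nat[OF x] by (simp add: binomial_gbinomial)
  have "((\<lambda>t. of_real x powr (-t - of_nat k)) has_field_derivative
           (- of_real (ln x) * of_real x powr (- ?t0 - of_nat k))) (at ?t0)"
  proof -
    have eq: "- t - of_nat k = - of_nat k - t" for t :: complex by simp
    show ?thesis unfolding eq by (rule powr_minus_has_derivative[OF x])
  qed
  moreover have "((\<lambda>t. (-t gchoose k)) has_field_derivative D * (-1)) (at ?t0)"
    by (rule DERIV_chain2[where g = uminus]) (use D in \<open>auto intro!: derivative_eq_intros\<close>)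
  ultimately have "(?g has_field_derivative
      (D * (-1) * zeta_neg (a + k)) * of_real x powr (- ?t0 - of_nat k) +
      (- of_real (ln x) * of_real x powr (- ?t0 - of_nat k)) * ((- ?t0 gchoose k) * zeta_neg (a + k))) (at ?t0)"
    by (intro DERIV_mult DERIV_cmult_right)
  also have "(D * (-1) * zeta_neg (a + k)) * of_real x powr (- ?t0 - of_nat k) +
      (- of_real (ln x) * of_real x powr (- ?t0 - of_nat k)) * ((- ?t0 gchoose k) * zeta_neg (a + k))
      = ?c * (- D - of_nat (N choose k) * of_real (ln x))"
    unfolding powr_at_neg_of_nat[OF x] by (simp add: binomial_gbinomial algebra_simps)
  finally have D': "(?g has_field_derivative ?c * (- D - of_nat (N choose k) * of_real (ln x))) (at ?t0)" .
  have "?g holomorphic_on UNIV" using x by (intro holomorphic_intros) auto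
  from bigo_zeta_pole[OF this open_UNIV UNIV_I D']
  show ?thesis
  proof (rule bigo_diff_cong)
    have eq: "s + t + of_nat k = 1 + (t - ?t0)" for t
      using s by (simp add: algebra_simps)
    show "eventually (\<lambda>t. ?g t * riemann_zeta (s + t + of_nat k) = ?g t * riemann_zeta (1 + (t - ?t0))) (at ?t0)"
      unfolding eq by simp
  qed (unfold g0, simp add: algebra_simps add_divide_distrib)
qed

lemma MT_lead_regular:
  assumes x: "x > 0" and s: "s \<noteq> of_nat (a + N + 2)"
  shows "(\<lambda>t. em_lead a t * of_real x powr (of_nat (Suc a) - t) * riemann_zeta (s + t - of_nat (Suc a))
            - (-1) ^ Suc a * fact a * fact N / fact (Suc (a + N)) * of_real x ^ Suc (a + N) * riemann_zeta (s - of_nat (Suc (a + N))))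
         \<in> O[at (- of_nat N)](\<lambda>t. t - (- of_nat N))"
proof -
  let ?h = "\<lambda>t. em_lead a t * of_real x powr (of_nat (Suc a) - t) * riemann_zeta (s + t - of_nat (Suc a))"
  \<comment> \<open>The poles of \<open>em_lead\<close> are the points 1, ..., a+1, so this half
    plane avoids them; the deleted point is the pole of the zeta factor.\<close>
  let ?S = "{t. Re t < 1} - {1 - s + of_nat (Suc a)}"
  have "(\<lambda>t. riemann_zeta (s + t - of_nat (Suc a))) holomorphic_on ?S"
    by (intro holomorphic_on_riemann_zeta_compose holomorphic_intros) (auto simp: algebra_simps)
  moreover have "em_lead a holomorphic_on ?S"
    by (intro holomorphic_on_em_lead) auto
  ultimately have "?h holomorphic_on ?S" using x by (intro holomorphic_intros) auto
  moreover have "- of_nat N \<in> ?S" using s by (auto simp: algebra_simps)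
  moreover have "open ?S" by (intro open_Diff open_halfspace_Re_lt) auto
  ultimately have "(\<lambda>t. ?h t - ?h (- of_nat N)) \<in> O[at (- of_nat N)](\<lambda>t. t - (- of_nat N))"
    by (intro bigo_diff_of_holomorphic[of _ ?S]) auto
  also have "?h (- of_nat N) = (-1) ^ Suc a * fact a * fact N / fact (Suc (a + N)) * of_real x ^ Suc (a + N) * riemann_zeta (s - of_nat (Suc (a + N)))"
  proof -
    have "of_nat (Suc a) - - of_nat N = (of_nat (Suc (a + N)) :: complex)"
         "s + - of_nat N - of_nat (Suc a) = s - of_nat (Suc (a + N))" by simp_all
    moreover have "of_real x powr (of_nat (Suc (a + N))) = (of_real x ^ Suc (a + N) :: complex)"
      using x by (intro powr_nat') auto
    ultimately show ?thesis by (simp only: em_lead_neg_of_nat)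
  qed
  finally show ?thesis .
qed

lemma MT_lead_pole:
  assumes x: "x > 0" and s: "s = of_nat (a + N + 2)"
  defines "C \<equiv> (-1) ^ Suc a * fact a * fact N / fact (Suc (a + N)) * of_real x ^ Suc (a + N) :: complex"
  shows "(\<lambda>t. em_lead a t * of_real x powr (of_nat (Suc a) - t) * riemann_zeta (s + t - of_nat (Suc a))
            - C * (1 / (t - (- of_nat N)) + euler_mascheroni - of_real (ln x) + harm (Suc (a + N)) - harm N))
         \<in> O[at (- of_nat N)](\<lambda>t. t - (- of_nat N))"
proof -
  let ?t0 = "- of_nat N :: complex"
  let ?g = "\<lambda>t. em_lead a t * of_real x powr (of_nat (Suc a) - t)"
  let ?S = "{t. Re t < 1}"
  have p0: "of_real x powr (of_nat (Suc a) - ?t0) = (of_real x ^ Suc (a + N) :: complex)"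
  proof -
    have "of_nat (Suc a) - - of_nat N = (of_nat (Suc (a + N)) :: complex)" by simp
    moreover have "of_real x powr (of_nat (Suc (a + N))) = (of_real x ^ Suc (a + N) :: complex)"
      using x by (intro powr_nat') auto
    ultimately show ?thesis by (simp only:)
  qed
  have g0: "?g ?t0 = C" unfolding p0 by (simp only: em_lead_neg_of_nat C_def)
  have "((\<lambda>t. of_real x powr (of_nat (Suc a) - t)) has_field_derivative
           (- of_real (ln x) * of_real x powr (of_nat (Suc a) - ?t0))) (at ?t0)"
    by (rule powr_minus_has_derivative[OF x])
  from DERIV_mult[OF em_lead_has_derivative this]
  have "(?g has_field_derivative (em_lead a ?t0 * (harm (Suc (a + N)) - harm N)) * of_real x powr (of_nat (Suc a) - ?t0) +
           (- of_real (ln x) * of_real x powr (of_nat (Suc a) - ?t0)) * em_lead a ?t0) (at ?t0)" .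
  also have "(em_lead a ?t0 * (harm (Suc (a + N)) - harm N)) * of_real x powr (of_nat (Suc a) - ?t0) +
           (- of_real (ln x) * of_real x powr (of_nat (Suc a) - ?t0)) * em_lead a ?t0
       = ?g ?t0 * (harm (Suc (a + N)) - harm N - of_real (ln x))"
    by (simp only: ring_distribs) (simp add: algebra_simps)
  finally have D: "(?g has_field_derivative C * (harm (Suc (a + N)) - harm N - of_real (ln x))) (at ?t0)"
    unfolding g0 .
  have "em_lead a holomorphic_on ?S" by (intro holomorphic_on_em_lead) auto
  hence "?g holomorphic_on ?S" using x by (intro holomorphic_intros) auto
  from bigo_zeta_pole[OF this open_halfspace_Re_lt _ D]
  have "(\<lambda>t. ?g t * riemann_zeta (1 + (t - ?t0)) - (?g ?t0 / (t - ?t0) +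
         (C * (harm (Suc (a + N)) - harm N - of_real (ln x)) + euler_mascheroni * ?g ?t0)))
        \<in> O[at ?t0](\<lambda>t. t - ?t0)" by simp
  thus ?thesis
  proof (rule bigo_diff_cong)
    have eq: "s + t - of_nat (Suc a) = 1 + (t - ?t0)" for t
      using s by (simp add: algebra_simps)
    show "eventually (\<lambda>t. ?g t * riemann_zeta (s + t - of_nat (Suc a)) = ?g t * riemann_zeta (1 + (t - ?t0))) (at ?t0)"
      unfolding eq by simp
  qed (unfold g0, simp add: algebra_simps add_divide_distrib)
qed

section \<open>Assembling the cases\<close>

definition MT_value :: "nat \<Rightarrow> nat \<Rightarrow> real \<Rightarrow> complex \<Rightarrow> nat \<Rightarrow> complex" where
  "MT_value a N x s k = of_nat (N choose k) * zeta_neg (a + k) * of_real x powi (int N - int k)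
                          * riemann_zeta (s - of_nat N + of_nat k)"

definition MT_lead_coeff :: "nat \<Rightarrow> nat \<Rightarrow> real \<Rightarrow> complex" where
  "MT_lead_coeff a N x = (-1) ^ Suc a * fact a * fact N / fact (Suc (a + N)) * of_real x ^ Suc (a + N)"

definition MT_cutoff :: "nat \<Rightarrow> nat \<Rightarrow> complex \<Rightarrow> nat" where
  "MT_cutoff a N s = a + N + 4 + nat \<lceil>\<bar>Re s\<bar>\<rceil>"

lemma MT_cutoff:
  "a + N + 1 < MT_cutoff a N s" "real (MT_cutoff a N s) > 3 + real a + real N - Re s"
proof -
  have "real (nat \<lceil>\<bar>Re s\<bar>\<rceil>) \<ge> \<bar>Re s\<bar>" by linarith
  thus "real (MT_cutoff a N s) > 3 + real a + real N - Re s"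
    unfolding MT_cutoff_def of_nat_add of_nat_numeral by linarith
qed (simp add: MT_cutoff_def)

text \<open>\<open>N choose k\<close> kills every term with \<open>k > N\<close>, so the result is
  independent of the truncation order. The set \<open>A\<close> is to hold the index of the zeta
  pole, if there is one.\<close>

lemma sum_MT_value:
  assumes "N < L"
  shows "(\<Sum>k\<in>{..<L} - A. MT_value a N x s k) = (\<Sum>k\<in>{0..N} - A. MT_value a N x s k)"
  by (rule sum.mono_neutral_right) (use assms in \<open>auto simp: MT_value_def\<close>)

lemma theta_expansion_no_zeta_pole:
  assumes x: "x > 0" and \<Theta>: "is_MT_zeta x \<Theta>"
    and s: "\<And>k. s + of_nat k \<noteq> of_nat (Suc N)"
    and lead: "(\<lambda>t. em_lead a t * of_real x powr (of_nat (Suc a) - t) * riemann_zeta (s + t - of_nat (Suc a)) - L t)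
                 \<in> O[at (- of_nat N)](\<lambda>t. t - (- of_nat N))"
  shows "(\<lambda>t. \<Theta> (- of_nat a) s t - (L t + (\<Sum>k=0..N. MT_value a N x s k)))
           \<in> O[at (- of_nat N)](\<lambda>t. t - (- of_nat N))"
proof -
  have "(\<lambda>t. \<Theta> (- of_nat a) s t - (L t + (\<Sum>k<MT_cutoff a N s - a. MT_value a N x s k)))
           \<in> O[at (- of_nat N)](\<lambda>t. t - (- of_nat N))"
    using MT_term_regular[OF x s, of _ a] unfolding MT_value_def
    by (intro theta_expansion[OF x \<Theta> MT_cutoff lead]) auto
  moreover have "(\<Sum>k<MT_cutoff a N s - a. MT_value a N x s k) = (\<Sum>k=0..N. MT_value a N x s k)"
    using sum_MT_value[where L = "MT_cutoff a N s - a" and A = "{}"] MT_cutoff(1)[of a N s] by simp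
  ultimately show ?thesis by simp
qed

lemma theta_expansion_zeta_pole:
  assumes x: "x > 0" and \<Theta>: "is_MT_zeta x \<Theta>"
    and s: "s + of_nat m = of_nat (Suc N)"
    and D: "((\<lambda>z. z gchoose m) has_field_derivative D) (at (of_nat N))"
  shows "(\<lambda>t. \<Theta> (- of_nat a) s t -
             (MT_lead_coeff a N x * riemann_zeta (s - of_nat (Suc (a + N)))
              + (\<Sum>k\<in>{0..N} - {m}. MT_value a N x s k)
              + zeta_neg (a + m) * of_real x powi (int N - int m) *
                (of_nat (N choose m) / (t - (- of_nat N))
                 + of_nat (N choose m) * (euler_mascheroni - of_real (ln x)) - D)))
           \<in> O[at (- of_nat N)](\<lambda>t. t - (- of_nat N))"
proof -
  define P where "P = (\<lambda>t. zeta_neg (a + m) * of_real x powi (int N - int m) *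
                (of_nat (N choose m) / (t - (- of_nat N))
                 + of_nat (N choose m) * (euler_mascheroni - of_real (ln x)) - D))"
  define V where "V = (\<lambda>k t. if k = m then P t else MT_value a N x s k)"
  define L where "L = MT_cutoff a N s - a"
  have s': "s = of_nat (Suc N) - of_nat m" using s by (simp add: algebra_simps)
  \<comment> \<open>The pole index is N + 1 - Re s and may exceed \<open>N\<close>; the summand with
    the norm of \<open>Re s\<close> in \<open>MT_cutoff\<close> ensures that the truncated sum still
    contains it.\<close>
  have mL: "m \<in> {..<L}"
  proof -
    have "Re s = real (Suc N) - real m" unfolding s' by simp
    moreover have "real (nat \<lceil>\<bar>Re s\<bar>\<rceil>) \<ge> \<bar>Re s\<bar>" by linarith
    ultimately have "real m < real L" unfolding L_def MT_cutoff_def by simp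
    thus ?thesis by simp
  qed
  have NL: "N < L" using MT_cutoff(1)[of a N s] by (simp add: L_def)
  have lead: "s \<noteq> of_nat (a + N + 2)"
  proof
    assume "s = of_nat (a + N + 2)"
    hence "of_nat (a + N + 2 + m) = (of_nat (Suc N) :: complex)" using s by simp
    thus False unfolding of_nat_eq_iff by simp
  qed
  have main: "(\<lambda>t. \<Theta> (- of_nat a) s t - (MT_lead_coeff a N x * riemann_zeta (s - of_nat (Suc (a + N))) + (\<Sum>k<L. V k t)))
           \<in> O[at (- of_nat N)](\<lambda>t. t - (- of_nat N))"
    unfolding L_def MT_lead_coeff_def
  proof (intro theta_expansion[OF x \<Theta> MT_cutoff MT_lead_regular[OF x lead]])
    fix k
    show "(\<lambda>t. (-t gchoose k) * zeta_neg (a + k) * of_real x powr (-t - of_nat k) * riemann_zeta (s + t + of_nat k) - V k t)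
                 \<in> O[at (- of_nat N)](\<lambda>t. t - (- of_nat N))"
    proof (cases "k = m")
      case True
      thus ?thesis using MT_term_pole[OF x s D, of a] by (simp add: V_def P_def)
    next
      case False
      have "s + of_nat k \<noteq> of_nat (Suc N)" using False s by (metis add_left_cancel of_nat_eq_iff)
      thus ?thesis using MT_term_regular[OF x, of s k N a] False by (simp add: V_def MT_value_def)
    qed
  qed
  have sum: "(\<Sum>k<L. V k t) = P t + (\<Sum>k\<in>{0..N} - {m}. MT_value a N x s k)" for t
  proof -
    have "(\<Sum>k<L. V k t) = V m t + (\<Sum>k\<in>{..<L} - {m}. V k t)"
      using mL by (intro sum.remove) auto
    also have "(\<Sum>k\<in>{..<L} - {m}. V k t) = (\<Sum>k\<in>{..<L} - {m}. MT_value a N x s k)"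
      by (intro sum.cong) (auto simp: V_def)
    also have "\<dots> = (\<Sum>k\<in>{0..N} - {m}. MT_value a N x s k)"
      by (rule sum_MT_value[OF NL])
    finally show ?thesis by (simp add: V_def)
  qed
  show ?thesis
    by (rule bigo_diff_cong[OF main]) (simp_all add: sum P_def del: of_nat_Suc)
qed

theorem theorem2p3:
  fixes x :: real and \<Theta> :: "complex \<Rightarrow> complex \<Rightarrow> complex \<Rightarrow> complex"
    and r :: int and l N :: nat and t0 X :: complex
  assumes "x > 0"
    and "is_MT_zeta x \<Theta>"
    and "r \<le> 0"
    and "int l \<ge> 1 - r"
  defines "t0 \<equiv> of_int (1 - r - int l)"
    and "N \<equiv> nat (r + int l - 1)"
    and "X \<equiv> of_real x"
  shows
    "(\<forall>s::complex. (\<exists>q::int. s = of_int q \<and> q > r + int l \<and> q \<noteq> int l + 1) \<or> s \<notin> \<int> \<longrightarrow>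
       (\<lambda>t. \<Theta> (of_int r) s t -
          ((-1) powi (r - 1) * (fact N / fact l) * X ^ l * fact (nat (- r)) * riemann_zeta (s - of_nat l)
           + (\<Sum>k=0..N. fact N * riemann_zeta (of_int r - of_nat k)
                / (X powi (1 - r - int l + int k) * fact k * fact (N - k))
                * riemann_zeta (- of_int r + s - of_nat l + of_nat k + 1))))
       \<in> O[at t0](\<lambda>t. t - t0))
     \<and>
     (\<lambda>t. \<Theta> (of_int r) (of_nat (l + 1)) t -
          ((-1) powi (r - 1) * fact (nat (- r)) * X ^ l * (fact N / (fact l * (t - t0)))
           + (-1) powi (r - 1) * fact (nat (- r)) * X ^ l * (fact N / fact l)
               * (euler_mascheroni - of_real (ln x) + harm l - harm N)
           + (\<Sum>k=0..N. of_nat (N choose k) * (riemann_zeta (of_int r - of_nat k)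
                / X powi (int k - r - int l + 1))
                * riemann_zeta (of_nat k - of_int r + 2))))
       \<in> O[at t0](\<lambda>t. t - t0)
     \<and>
     (\<forall>s::int. s \<le> 0 \<and> s \<le> r + int l \<longrightarrow>
       (\<lambda>t. \<Theta> (of_int r) (of_int s) t -
          ((-1) powi (r - 1) * X ^ l * (fact (nat (- r)) * fact N / fact l)
               * riemann_zeta (of_int s - of_nat l)
           + (\<Sum>k=0..N. riemann_zeta (of_int r - of_nat k) * fact N
                / (X powi (int k - r - int l + 1) * fact k * fact (N - k))
                * riemann_zeta (of_int s + 1 - of_int r - of_nat l + of_nat k))
           + (-1) powi (s - 1) * X powi (s - 1)
               * (fact N * fact (nat (- s)) / fact (nat (r + int l - s)))
               * riemann_zeta (of_int s - of_nat l)))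
       \<in> O[at t0](\<lambda>t. t - t0))
     \<and>
     (\<forall>s::int. s \<ge> 1 \<and> s \<le> r + int l \<longrightarrow>
       (\<lambda>t. \<Theta> (of_int r) (of_int s) t -
          (X powi (s - 1) * (fact N / (fact (nat (r + int l - s)) * fact (nat (s - 1))))
               * (riemann_zeta (of_int s - of_nat l) / (t - t0))
           + X powi (s - 1) * (fact N / (fact (nat (r + int l - s)) * fact (nat (s - 1))))
               * (euler_mascheroni - harm N + harm (nat (s - 1)) - of_real (ln x))
               * riemann_zeta (of_int s - of_nat l)
           - (-1) powi r * X ^ l * (fact (nat (- r)) * fact N / fact l)
               * riemann_zeta (of_int s - of_nat l)
           + (\<Sum>k\<in>{k\<in>{0..N}. int k \<noteq> r + int l - s}. fact N * riemann_zeta (of_int r - of_nat k)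
                / (fact (N - k) * X powi (int k - r - int l + 1) * fact k)
                * riemann_zeta (of_int s - of_int r - of_nat l + of_nat k + 1))))
       \<in> O[at t0](\<lambda>t. t - t0))"
proof -
  note x = \<open>x > 0\<close> and \<Theta> = \<open>is_MT_zeta x \<Theta>\<close>
  define a where "a = nat (- r)"
  have r: "r = - int a" using assms(3) by (simp add: a_def)
  have l: "l = Suc (a + N)" using assms(3,4) by (simp add: a_def N_def)
  have t0: "t0 = - of_nat N" unfolding t0_def r l by simp
  have X: "X \<noteq> 0" using x by (simp add: X_def)
  have sign: "(-1) powi (r - 1) = ((-1) ^ Suc a :: complex)" "(-1) powi r = ((-1) ^ a :: complex)"
  proof -
    have "r - 1 = - int (Suc a)" by (simp add: r)
    thus "(-1) powi (r - 1) = ((-1) ^ Suc a :: complex)"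
      by (simp only: power_int_minus power_int_of_nat power_inverse [symmetric]) simp
    show "(-1) powi r = ((-1) ^ a :: complex)"
      by (simp only: r power_int_minus power_int_of_nat power_inverse [symmetric]) simp
  qed
  have C: "MT_lead_coeff a N x = (-1) powi (r - 1) * fact (nat (- r)) * fact N / fact l * X ^ l"
    unfolding MT_lead_coeff_def sign a_def [symmetric] l X_def by simp
  have val: "MT_value a N x s k = of_nat (N choose k) * riemann_zeta (of_int r - of_nat k) / X powi (int k - int N)
               * riemann_zeta (s - of_nat N + of_nat k)" for s k
  proof -
    have "riemann_zeta (of_int r - of_nat k) = zeta_neg (a + k)"
      using riemann_zeta_neg_of_nat[of "a + k"] by (simp add: r)
    moreover have "X powi (int N - int k) = inverse (X powi (int k - int N))"
      by (simp add: power_int_minus [symmetric])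
    ultimately show ?thesis by (simp add: MT_value_def X_def divide_inverse)
  qed
  have exps: "1 - r - int l + int k = int k - int N" "int k - r - int l + 1 = int k - int N" for k
    by (simp_all add: r l)
  have args: "- of_int r + s - of_nat l + of_nat k + 1 = s - of_nat N + (of_nat k :: complex)"
             "s + 1 - of_int r - of_nat l + of_nat k = s - of_nat N + (of_nat k :: complex)"
             "s - of_int r - of_nat l + of_nat k + 1 = s - of_nat N + (of_nat k :: complex)" for s k
    by (simp_all add: r l)
  have rl: "r + int l = int (Suc N)" by (simp add: r l)
  show ?thesis
  proof (intro conjI allI impI)
    fix s :: complex
    assume s: "(\<exists>q::int. s = of_int q \<and> q > r + int l \<and> q \<noteq> int l + 1) \<or> s \<notin> \<int>"
    \<comment> \<open>For \<open>s\<close> outside the integers this is vacuous. For integral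
      \<open>s\<close>, the first inequality keeps every zeta argument \<open>s - N + k\<close>
      above 1, and the second excludes the pole of the leading term.\<close>
    have int_s: "q > r + int l \<and> q \<noteq> int l + 1" if "s = of_int q" for q
      using s that by auto
    have "s + of_nat k \<noteq> of_nat (Suc N)" for k
    proof
      assume "s + of_nat k = of_nat (Suc N)"
      hence "s = of_int (int (Suc N) - int k)" by (simp add: algebra_simps)
      from int_s[OF this] show False by (simp add: rl)
    qed
    moreover have "s \<noteq> of_nat (a + N + 2)"
    proof
      assume "s = of_nat (a + N + 2)"
      hence "s = of_int (int (a + N + 2))" by simp
      from int_s[OF this] show False by (simp add: l)
    qed
    ultimately have "(\<lambda>t. \<Theta> (- of_nat a) s t - (MT_lead_coeff a N x * riemann_zeta (s - of_nat l) +
             (\<Sum>k=0..N. MT_value a N x s k))) \<in> O[at t0](\<lambda>t. t - t0)"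
      unfolding t0 l MT_lead_coeff_def by (intro theta_expansion_no_zeta_pole[OF x \<Theta>] MT_lead_regular[OF x])
    thus "(\<lambda>t. \<Theta> (of_int r) s t -
          ((-1) powi (r - 1) * (fact N / fact l) * X ^ l * fact (nat (- r)) * riemann_zeta (s - of_nat l)
           + (\<Sum>k=0..N. fact N * riemann_zeta (of_int r - of_nat k)
                / (X powi (1 - r - int l + int k) * fact k * fact (N - k))
                * riemann_zeta (- of_int r + s - of_nat l + of_nat k + 1))))
       \<in> O[at t0](\<lambda>t. t - t0)"
    proof (rule bigo_diff_cong)
      have "(\<Sum>k=0..N. MT_value a N x s k) = (\<Sum>k=0..N. fact N * riemann_zeta (of_int r - of_nat k)
                / (X powi (1 - r - int l + int k) * fact k * fact (N - k))
                * riemann_zeta (- of_int r + s - of_nat l + of_nat k + 1))"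
        unfolding val exps args by (intro sum.cong refl) (simp add: binomial_fact mult_ac)
      thus "(-1) powi (r - 1) * (fact N / fact l) * X ^ l * fact (nat (- r)) * riemann_zeta (s - of_nat l)
           + (\<Sum>k=0..N. fact N * riemann_zeta (of_int r - of_nat k)
                / (X powi (1 - r - int l + int k) * fact k * fact (N - k))
                * riemann_zeta (- of_int r + s - of_nat l + of_nat k + 1))
         = MT_lead_coeff a N x * riemann_zeta (s - of_nat l) + (\<Sum>k=0..N. MT_value a N x s k)" for t :: complex
        unfolding C by simp
    qed (simp add: r)
  next
    have s: "of_nat (l + 1) = (of_nat (a + N + 2) :: complex)" by (simp add: l)
    have "of_nat (l + 1) + of_nat k \<noteq> (of_nat (Suc N) :: complex)" for k
      unfolding of_nat_add [symmetric] of_nat_eq_iff by (simp add: l)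
    hence "(\<lambda>t. \<Theta> (- of_nat a) (of_nat (l + 1)) t -
             (MT_lead_coeff a N x * (1 / (t - t0) + euler_mascheroni - of_real (ln x) + harm l - harm N) +
             (\<Sum>k=0..N. MT_value a N x (of_nat (l + 1)) k))) \<in> O[at t0](\<lambda>t. t - t0)"
      using MT_lead_pole[OF x s] unfolding t0 MT_lead_coeff_def
      by (intro theta_expansion_no_zeta_pole[OF x \<Theta>]) (simp_all add: l)
    thus "(\<lambda>t. \<Theta> (of_int r) (of_nat (l + 1)) t -
          ((-1) powi (r - 1) * fact (nat (- r)) * X ^ l * (fact N / (fact l * (t - t0)))
           + (-1) powi (r - 1) * fact (nat (- r)) * X ^ l * (fact N / fact l)
               * (euler_mascheroni - of_real (ln x) + harm l - harm N)
           + (\<Sum>k=0..N. of_nat (N choose k) * (riemann_zeta (of_int r - of_nat k)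
                / X powi (int k - r - int l + 1))
                * riemann_zeta (of_nat k - of_int r + 2))))
       \<in> O[at t0](\<lambda>t. t - t0)"
    proof (rule bigo_diff_cong)
      have arg: "of_nat (l + 1) - of_nat N + of_nat k = of_nat k - of_int r + (2 :: complex)" for k
        by (simp add: r l)
      have sum: "(\<Sum>k=0..N. MT_value a N x (of_nat (l + 1)) k) =
              (\<Sum>k=0..N. of_nat (N choose k) * (riemann_zeta (of_int r - of_nat k)
                / X powi (int k - r - int l + 1)) * riemann_zeta (of_nat k - of_int r + 2))"
        unfolding val exps arg by simp
      show "(-1) powi (r - 1) * fact (nat (- r)) * X ^ l * (fact N / (fact l * (t - t0)))
           + (-1) powi (r - 1) * fact (nat (- r)) * X ^ l * (fact N / fact l)
               * (euler_mascheroni - of_real (ln x) + harm l - harm N)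
           + (\<Sum>k=0..N. of_nat (N choose k) * (riemann_zeta (of_int r - of_nat k)
                / X powi (int k - r - int l + 1))
                * riemann_zeta (of_nat k - of_int r + 2))
         = MT_lead_coeff a N x * (1 / (t - t0) + euler_mascheroni - of_real (ln x) + harm l - harm N)
           + (\<Sum>k=0..N. MT_value a N x (of_nat (l + 1)) k)" for t
        unfolding sum C by (simp add: algebra_simps add_divide_distrib diff_divide_distrib)
    qed (simp add: r)
  next
    fix s :: int
    assume s: "s \<le> 0 \<and> s \<le> r + int l"
    define d where "d = nat (- s)"
    \<comment> \<open>The pole of zeta sits at index \<open>m > N\<close>, where the binomial
      vanishes at \<open>-N\<close>: no singular part survives, and the derivative of the binomial
      yields the extra term.\<close>
    define m where "m = Suc (N + d)"
    have sd: "s = - int d" using s by (simp add: d_def)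
    have sm: "of_int s + of_nat m = (of_nat (Suc N) :: complex)" by (simp add: sd m_def)
    have nm: "nat (r + int l - s) = m" unfolding rl by (simp add: sd m_def)
    have "(\<lambda>t. \<Theta> (- of_nat a) (of_int s) t -
             (MT_lead_coeff a N x * riemann_zeta (of_int s - of_nat l)
              + (\<Sum>k\<in>{0..N} - {m}. MT_value a N x (of_int s) k)
              + zeta_neg (a + m) * X powi (int N - int m) *
                (of_nat (N choose m) / (t - t0)
                 + of_nat (N choose m) * (euler_mascheroni - of_real (ln x)) - (-1) ^ d * fact N * fact d / fact m)))
           \<in> O[at t0](\<lambda>t. t - t0)"
      using theta_expansion_zeta_pole[OF x \<Theta> sm gbinomial_has_derivative_gt[of N d, folded m_def], of a]
      unfolding t0 l X_def .
    thus "(\<lambda>t. \<Theta> (of_int r) (of_int s) t -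
          ((-1) powi (r - 1) * X ^ l * (fact (nat (- r)) * fact N / fact l)
               * riemann_zeta (of_int s - of_nat l)
           + (\<Sum>k=0..N. riemann_zeta (of_int r - of_nat k) * fact N
                / (X powi (int k - r - int l + 1) * fact k * fact (N - k))
                * riemann_zeta (of_int s + 1 - of_int r - of_nat l + of_nat k))
           + (-1) powi (s - 1) * X powi (s - 1)
               * (fact N * fact (nat (- s)) / fact (nat (r + int l - s)))
               * riemann_zeta (of_int s - of_nat l)))
       \<in> O[at t0](\<lambda>t. t - t0)"
    proof (rule bigo_diff_cong)
      have "(\<Sum>k\<in>{0..N} - {m}. MT_value a N x (of_int s) k) = (\<Sum>k=0..N. MT_value a N x (of_int s) k)"
        by (rule sum.cong) (auto simp: m_def)
      also have "\<dots> = (\<Sum>k=0..N. riemann_zeta (of_int r - of_nat k) * fact N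
                / (X powi (int k - r - int l + 1) * fact k * fact (N - k))
                * riemann_zeta (of_int s + 1 - of_int r - of_nat l + of_nat k))"
        unfolding val exps args by (intro sum.cong refl) (simp add: binomial_fact mult_ac)
      finally have sum: "(\<Sum>k\<in>{0..N} - {m}. MT_value a N x (of_int s) k) = \<dots>" .
      have "zeta_neg (a + m) * X powi (int N - int m) *
                (of_nat (N choose m) / (t - t0)
                 + of_nat (N choose m) * (euler_mascheroni - of_real (ln x)) - (-1) ^ d * fact N * fact d / fact m)
           = (-1) powi (s - 1) * X powi (s - 1) * (fact N * fact (nat (- s)) / fact (nat (r + int l - s)))
               * riemann_zeta (of_int s - of_nat l)" for t
      proof -
        \<comment> \<open>The coefficient \<open>zeta_neg (a + m)\<close> of the critical summand is
          thus the same zeta value as the one in the leading term.\<close>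
        have "of_int s - of_nat l = (- of_nat (a + m) :: complex)" by (simp add: sd m_def l)
        hence 1: "riemann_zeta (of_int s - of_nat l) = zeta_neg (a + m)" by (simp only: riemann_zeta_neg_of_nat)
        have "s - 1 = - int (Suc d)" by (simp add: sd)
        hence 2: "(-1) powi (s - 1) = ((-1) ^ Suc d :: complex)"
          by (simp only: power_int_minus power_int_of_nat power_inverse [symmetric]) simp
        have 3: "int N - int m = s - 1" by (simp add: sd m_def)
        have 4: "N choose m = 0" by (simp add: m_def)
        show ?thesis unfolding 1 2 3 4 nm d_def [symmetric] by simp
      qed
      thus "(-1) powi (r - 1) * X ^ l * (fact (nat (- r)) * fact N / fact l)
               * riemann_zeta (of_int s - of_nat l)
           + (\<Sum>k=0..N. riemann_zeta (of_int r - of_nat k) * fact N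
                / (X powi (int k - r - int l + 1) * fact k * fact (N - k))
                * riemann_zeta (of_int s + 1 - of_int r - of_nat l + of_nat k))
           + (-1) powi (s - 1) * X powi (s - 1)
               * (fact N * fact (nat (- s)) / fact (nat (r + int l - s)))
               * riemann_zeta (of_int s - of_nat l)
         = MT_lead_coeff a N x * riemann_zeta (of_int s - of_nat l)
              + (\<Sum>k\<in>{0..N} - {m}. MT_value a N x (of_int s) k)
              + zeta_neg (a + m) * X powi (int N - int m) *
                (of_nat (N choose m) / (t - t0)
                 + of_nat (N choose m) * (euler_mascheroni - of_real (ln x)) - (-1) ^ d * fact N * fact d / fact m)" for t
        unfolding sum C by (simp add: mult_ac)
    qed (simp add: r)
  next
    fix s :: int
    assume s: "s \<ge> 1 \<and> s \<le> r + int l"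
    define j where "j = nat (s - 1)"
    \<comment> \<open>Here the pole index satisfies \<open>m \<le> N\<close>, so the binomial is
      nonzero and a genuine pole appears. As \<open>N - m = j = s - 1\<close>, the derivative of the
      binomial contributes the harmonic number of index \<open>s - 1\<close>.\<close>
    define m where "m = N - j"
    have sj: "s = int (Suc j)" using s by (simp add: j_def)
    have jN: "j \<le> N" using s unfolding rl by (simp add: sj)
    have Nj: "N - m = j" "m \<le> N" using jN by (simp_all add: m_def)
    have sm: "of_int s + of_nat m = (of_nat (Suc N) :: complex)" using jN by (simp add: sj m_def of_nat_diff)
    have rls: "r + int l - s = int m" unfolding rl using jN by (simp add: sj m_def of_nat_diff)
    have "(\<lambda>t. \<Theta> (- of_nat a) (of_int s) t -
             (MT_lead_coeff a N x * riemann_zeta (of_int s - of_nat l)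
              + (\<Sum>k\<in>{0..N} - {m}. MT_value a N x (of_int s) k)
              + zeta_neg (a + m) * X powi (int N - int m) *
                (of_nat (N choose m) / (t - t0)
                 + of_nat (N choose m) * (euler_mascheroni - of_real (ln x)) - of_nat (N choose m) * (harm N - harm j))))
           \<in> O[at t0](\<lambda>t. t - t0)"
      using theta_expansion_zeta_pole[OF x \<Theta> sm gbinomial_has_derivative_le[OF Nj(2), unfolded Nj(1)], of a]
      unfolding t0 l X_def .
    thus "(\<lambda>t. \<Theta> (of_int r) (of_int s) t -
          (X powi (s - 1) * (fact N / (fact (nat (r + int l - s)) * fact (nat (s - 1))))
               * (riemann_zeta (of_int s - of_nat l) / (t - t0))
           + X powi (s - 1) * (fact N / (fact (nat (r + int l - s)) * fact (nat (s - 1))))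
               * (euler_mascheroni - harm N + harm (nat (s - 1)) - of_real (ln x))
               * riemann_zeta (of_int s - of_nat l)
           - (-1) powi r * X ^ l * (fact (nat (- r)) * fact N / fact l)
               * riemann_zeta (of_int s - of_nat l)
           + (\<Sum>k\<in>{k\<in>{0..N}. int k \<noteq> r + int l - s}. fact N * riemann_zeta (of_int r - of_nat k)
                / (fact (N - k) * X powi (int k - r - int l + 1) * fact k)
                * riemann_zeta (of_int s - of_int r - of_nat l + of_nat k + 1))))
       \<in> O[at t0](\<lambda>t. t - t0)"
    proof (rule bigo_diff_cong)
      have set: "{0..N} - {m} = {k\<in>{0..N}. int k \<noteq> r + int l - s}" by (auto simp: rls)
      have sum: "(\<Sum>k\<in>{0..N} - {m}. MT_value a N x (of_int s) k) =
         (\<Sum>k\<in>{k\<in>{0..N}. int k \<noteq> r + int l - s}. fact N * riemann_zeta (of_int r - of_nat k)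
                / (fact (N - k) * X powi (int k - r - int l + 1) * fact k)
                * riemann_zeta (of_int s - of_int r - of_nat l + of_nat k + 1))"
        unfolding set val exps args by (intro sum.cong refl) (simp add: binomial_fact mult_ac)
      have "of_int s - of_nat l = (- of_nat (a + m) :: complex)" using jN by (simp add: sj m_def l of_nat_diff)
      hence z: "riemann_zeta (of_int s - of_nat l) = zeta_neg (a + m)" by (simp only: riemann_zeta_neg_of_nat)
      have p: "int N - int m = s - 1" using jN by (simp add: sj m_def of_nat_diff)
      have c: "fact N / (fact (nat (r + int l - s)) * fact (nat (s - 1))) = (of_nat (N choose m) :: complex)"
        unfolding rls using Nj by (simp add: binomial_fact j_def [symmetric])
      have C': "MT_lead_coeff a N x = - ((-1) powi r * X ^ l * (fact (nat (- r)) * fact N / fact l))"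
        unfolding C sign by simp
      show "X powi (s - 1) * (fact N / (fact (nat (r + int l - s)) * fact (nat (s - 1))))
               * (riemann_zeta (of_int s - of_nat l) / (t - t0))
           + X powi (s - 1) * (fact N / (fact (nat (r + int l - s)) * fact (nat (s - 1))))
               * (euler_mascheroni - harm N + harm (nat (s - 1)) - of_real (ln x))
               * riemann_zeta (of_int s - of_nat l)
           - (-1) powi r * X ^ l * (fact (nat (- r)) * fact N / fact l)
               * riemann_zeta (of_int s - of_nat l)
           + (\<Sum>k\<in>{k\<in>{0..N}. int k \<noteq> r + int l - s}. fact N * riemann_zeta (of_int r - of_nat k)
                / (fact (N - k) * X powi (int k - r - int l + 1) * fact k)
                * riemann_zeta (of_int s - of_int r - of_nat l + of_nat k + 1))
         = MT_lead_coeff a N x * riemann_zeta (of_int s - of_nat l)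
              + (\<Sum>k\<in>{0..N} - {m}. MT_value a N x (of_int s) k)
              + zeta_neg (a + m) * X powi (int N - int m) *
                (of_nat (N choose m) / (t - t0)
                 + of_nat (N choose m) * (euler_mascheroni - of_real (ln x)) - of_nat (N choose m) * (harm N - harm j))" for t
        unfolding sum C' z p c unfolding j_def [symmetric] by (simp add: algebra_simps)
    qed (simp add: r)
  qed
qed

end
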